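(* We have $$\frac{8}{49}n^2-o(n^2)\le g(n,P_4,P_5)\le \frac{4}{23}n^2+o(n^2).$$
   Context: $P_r$ denotes the path on $r$ vertices. For fixed graphs $H$ and $F$, the Constructor–Blocker game is played on the edge set of $K_n$: Constructor and Blocker alternately claim previously unclaimed edges, Constructor moving first. Constructor may only claim an edge if after claiming it his graph (all edges he has claimed) contains no copy of $F$ as a subgraph; Blocker may claim any unclaimed edge. The game ends when Constructor cannot claim a further edge or all edges are claimed. The score is the number of copies of $H$ (as subgraphs) all of whose edges were claimed by Constructor. Constructor maximizes, Blocker minimizes the score; $g(n,H,F)$ is the score under optimal play by both players. *)

theory Defs
  imports Complex_Main "HOL-Library.Landau_Symbols"
begin

text \<open>A simple graph is a vertex set together with a set of two-element subsets of it.\<close>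

type_synonym 'a graph = "'a set \<times> 'a set set"

abbreviation verts :: "'a graph \<Rightarrow> 'a set" where
  "verts G \<equiv> fst G"

abbreviation edges :: "'a graph \<Rightarrow> 'a set set" where
  "edges G \<equiv> snd G"

definition complete_graph :: "nat \<Rightarrow> nat graph" where
  "complete_graph n = ({..<n}, {e. e \<subseteq> {..<n} \<and> card e = 2})"

text \<open>The index \<open>r\<close> counts vertices: \<open>path_graph r\<close> has \<open>r - 1\<close> edges.\<close>

definition path_graph :: "nat \<Rightarrow> nat graph" where
  "path_graph r = ({..<r}, {{i, Suc i} | i. Suc i < r})"

definition subgraph :: "'a graph \<Rightarrow> 'a graph \<Rightarrow> bool" where
  "subgraph G' G \<longleftrightarrow> verts G' \<subseteq> verts G \<and> edges G' \<subseteq> edges G"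

definition isomorphic :: "'a graph \<Rightarrow> 'b graph \<Rightarrow> bool" where
  "isomorphic G G' \<longleftrightarrow>
     (\<exists>f. bij_betw f (verts G) (verts G') \<and> edges G' = (\<lambda>e. f ` e) ` edges G)"

text \<open>Copies are subgraphs, not necessarily induced; they are unlabelled, so a path
  and its reversal are the same copy.\<close>

definition copies :: "'a graph \<Rightarrow> 'b graph \<Rightarrow> 'b graph set" where
  "copies H G = {S. subgraph S G \<and> isomorphic H S}"

text \<open>In a position \<open>C\<close> and \<open>B\<close> are the sets of edges of \<open>complete_graph n\<close> claimed so far by
  Constructor and Blocker.\<close>

definition unclaimed :: "nat \<Rightarrow> nat set set \<Rightarrow> nat set set \<Rightarrow> nat set set" where
  "unclaimed n C B = edges (complete_graph n) - (C \<union> B)"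

definition constructor_moves ::
    "nat \<Rightarrow> 'b graph \<Rightarrow> nat set set \<Rightarrow> nat set set \<Rightarrow> nat set set" where
  "constructor_moves n F C B =
     {e \<in> unclaimed n C B. copies F ({..<n}, insert e C) = {}}"

definition game_over :: "nat \<Rightarrow> 'b graph \<Rightarrow> nat set set \<Rightarrow> nat set set \<Rightarrow> bool" where
  "game_over n F C B \<longleftrightarrow> constructor_moves n F C B = {} \<or> unclaimed n C B = {}"

definition score :: "nat \<Rightarrow> 'a graph \<Rightarrow> nat set set \<Rightarrow> nat" where
  "score n H C = card (copies H ({..<n}, C))"

datatype player = Constructor | Blocker

lemma finite_unclaimed: "finite (unclaimed n C B)"
  unfolding unclaimed_def complete_graph_def
  by (rule finite_subset[of _ "Pow {..<n}"]) auto

text \<open>\<open>game_value n H F p C B\<close> is the final score under optimal play from the position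
  \<open>(C, B)\<close> with player \<open>p\<close> to move. The sets under \<open>Max\<close> and \<open>Min\<close> are finite, and nonempty
  because the game is not over.\<close>

function game_value ::
    "nat \<Rightarrow> 'a graph \<Rightarrow> 'b graph \<Rightarrow> player \<Rightarrow> nat set set \<Rightarrow> nat set set \<Rightarrow> nat" where
  "game_value n H F p C B =
     (if game_over n F C B then score n H C
      else case p of
        Constructor \<Rightarrow>
          Max ((\<lambda>e. game_value n H F Blocker (insert e C) B) ` constructor_moves n F C B)
      | Blocker \<Rightarrow>
          Min ((\<lambda>e. game_value n H F Constructor C (insert e B)) ` unclaimed n C B))"
  by pat_completeness auto
termination
proof (relation "measure (\<lambda>(n, H, F, p, C, B). card (unclaimed n C B))", goal_cases)
  case 1
  show ?case by simp
next
  case (2 n H F p C B e)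
  then have "unclaimed n (insert e C) B \<subset> unclaimed n C B"
    by (auto simp: constructor_moves_def unclaimed_def)
  then show ?case by (simp add: psubset_card_mono finite_unclaimed)
next
  case (3 n H F p C B e)
  then have "unclaimed n C (insert e B) \<subset> unclaimed n C B"
    by (auto simp: unclaimed_def)
  then show ?case by (simp add: psubset_card_mono finite_unclaimed)
qed

declare game_value.simps [simp del]

definition g :: "nat \<Rightarrow> 'a graph \<Rightarrow> 'b graph \<Rightarrow> nat" where
  "g n H F = game_value n H F Constructor {} {}"

end

theory Submission
  imports Defs "HOL-Real_Asymp.Real_Asymp"
begin

text \<open>A component of Constructor's graph on at least five vertices is a star, a star with one extra
  edge, or a double star, so up to \<open>o(n\<^sup>2)\<close> the score is the sum of \<open>a b\<close> over the double stars,
  \<open>a\<close> and \<open>b\<close> being the numbers of leaves at the two centres.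

  Blocker forces \<open>3 a + 2 b \<le> 2 n + o(n)\<close>, in one of the two orders, on every double star with two
  centres of degree at least \<open>k \<approx> \<surd>n\<close>. He answers an edge at the centre \<open>u\<close> of a large star with an
  edge at \<open>u\<close>, preferring those that lead to another large star, so that Constructor only ever joins
  \<open>u\<close> to a centre \<open>v\<close> of small degree. After that he removes a vertex available to both centres from
  \<open>u\<close>, or one already removed from \<open>u\<close> from \<open>v\<close> as well. Since the double stars share \<open>n\<close> vertices,
  the sum of the products is at most \<open>4/23 n\<^sup>2\<close>.

  Constructor opens with an edge \<open>{u, v}\<close> and always extends the double star on it. Let \<open>q = 3n/7\<close>. He
  first reacts to the removal of a vertex from one centre by attaching it to the other. Once one
  centre, say \<open>v\<close>, has \<open>q\<close> leaves, he answers the removal of a vertex from \<open>u\<close> by attaching another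
  one to \<open>u\<close>, and leaves the removed ones for \<open>v\<close>. This yields \<open>a \<ge> 2n/7\<close>, \<open>b \<ge> 3n/7\<close> and
  \<open>3 a + 2 b \<ge> 2 n\<close> up to constants, hence \<open>a b \<ge> 8/49 n\<^sup>2 - O(n)\<close>.\<close>

section \<open>Copies of paths and strategies\<close>


lemma edges_complete_graph_iff:
  "e \<in> edges (complete_graph n) \<longleftrightarrow> (\<exists>u v. u < n \<and> v < n \<and> u \<noteq> v \<and> e = {u, v})"
  by (auto simp: complete_graph_def card_2_iff)

lemma pair_edge_iff: "{u, v} \<in> edges (complete_graph n) \<longleftrightarrow> u < n \<and> v < n \<and> u \<noteq> v"
  by (auto simp: complete_graph_def card_2_iff doubleton_eq_iff)

text \<open>Replaces the isomorphism by an injective enumeration \<open>f\<close> of the vertices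
  along the path. An \<open>f\<close> and its reversal describe the same copy, so this is a
  criterion and not a parametrisation.\<close>

lemma copies_path_graph_iff:
  "S \<in> copies (path_graph r) (V, E) \<longleftrightarrow>
     (\<exists>f. inj_on f {..<r} \<and> f ` {..<r} \<subseteq> V \<and> (\<forall>i. Suc i < r \<longrightarrow> {f i, f (Suc i)} \<in> E) \<and>
          S = (f ` {..<r}, {{f i, f (Suc i)} |i. Suc i < r}))" (is "?l \<longleftrightarrow> ?r")
proof -
  have im: "(\<lambda>e. f ` e) ` edges (path_graph r) = {{f i, f (Suc i)} |i. Suc i < r}" for f :: "nat \<Rightarrow> 'a"
    by (auto simp: path_graph_def image_iff) blast
  show ?thesis
  proof
    assume ?l
    then obtain f where f: "bij_betw f {..<r} (verts S)"
        "edges S = (\<lambda>e. f ` e) ` edges (path_graph r)" "verts S \<subseteq> V" "edges S \<subseteq> E"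
      by (auto simp: copies_def isomorphic_def subgraph_def path_graph_def)
    have "f ` {..<r} = verts S" "inj_on f {..<r}"
      using f(1) by (auto simp: bij_betw_def)
    moreover have "edges S = {{f i, f (Suc i)} |i. Suc i < r}"
      using f(2) im by simp
    ultimately show ?r
      using f(3,4) by (intro exI[of _ f]) (auto simp: prod_eq_iff)
  next
    assume ?r
    then obtain f where f: "inj_on f {..<r}" "f ` {..<r} \<subseteq> V"
      "\<forall>i. Suc i < r \<longrightarrow> {f i, f (Suc i)} \<in> E" "S = (f ` {..<r}, {{f i, f (Suc i)} |i. Suc i < r})"
      by blast
    then have "isomorphic (path_graph r) S"
      unfolding isomorphic_def im by (intro exI[of _ f]) (auto simp: bij_betw_def path_graph_def)
    then show ?l
      using f by (auto simp: copies_def subgraph_def)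
  qed
qed

text \<open>Spelled out with five distinct vertices, so that a forbidden path is exhibited by naming
  its vertices. On edge sets of \<open>complete_graph n\<close> it agrees with the rule of the game
  by \<open>copies_P5_empty_iff\<close>.\<close>

definition P5_free :: "'a set set \<Rightarrow> bool" where
  "P5_free E \<longleftrightarrow> (\<nexists>a b c d e. distinct [a, b, c, d, e] \<and>
     {a, b} \<in> E \<and> {b, c} \<in> E \<and> {c, d} \<in> E \<and> {d, e} \<in> E)"

lemma P5_freeD:
  "\<lbrakk>P5_free E; {a, b} \<in> E; {b, c} \<in> E; {c, d} \<in> E; {d, e} \<in> E; distinct [a, b, c, d, e]\<rbrakk> \<Longrightarrow> False"
  unfolding P5_free_def by blast

lemma lessThan_5: "{..<5} = {0, 1, 2, 3, 4::nat}"
  by auto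

lemma copies_P5_empty_iff:
  assumes "E \<subseteq> edges (complete_graph n)"
  shows "copies (path_graph 5) ({..<n}, E) = {} \<longleftrightarrow> P5_free E"
proof
  assume l: "copies (path_graph 5) ({..<n}, E) = {}"
  show "P5_free E"
    unfolding P5_free_def
  proof clarify
    fix a b c d e
    assume *: "distinct [a, b, c, d, e]" "{a, b} \<in> E" "{b, c} \<in> E" "{c, d} \<in> E" "{d, e} \<in> E"
    define f where "f = (!) [a, b, c, d, e]"
    have "inj_on f {..<5}"
      unfolding f_def using *(1) by (rule inj_on_nth) simp
    moreover have "f ` {..<5} \<subseteq> {..<n}"
    proof -
      have "{a, b} \<in> edges (complete_graph n)" "{b, c} \<in> edges (complete_graph n)"
        "{c, d} \<in> edges (complete_graph n)" "{d, e} \<in> edges (complete_graph n)"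
        using * assms by blast+
      then have "set [a, b, c, d, e] \<subseteq> {..<n}"
        by (simp add: pair_edge_iff)
      then show ?thesis
        by (simp add: f_def lessThan_5)
    qed
    moreover have "{f i, f (Suc i)} \<in> E" if "Suc i < 5" for i
    proof -
      have "i = 0 \<or> i = 1 \<or> i = 2 \<or> i = 3"
        using that by linarith
      then show ?thesis
        using *(2-5) by (elim disjE) (simp_all add: f_def numeral_eq_Suc)
    qed
    ultimately have "(f ` {..<5}, {{f i, f (Suc i)} |i. Suc i < 5}) \<in> copies (path_graph 5) ({..<n}, E)"
      unfolding copies_path_graph_iff by (intro exI[of _ f]) simp
    then show False
      using l by simp
  qed
next
  assume r: "P5_free E"
  show "copies (path_graph 5) ({..<n}, E) = {}"
  proof (rule ccontr)
    assume "copies (path_graph 5) ({..<n}, E) \<noteq> {}"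
    then obtain S where "S \<in> copies (path_graph 5) ({..<n}, E)"
      by blast
    then obtain f where f: "inj_on f {..<5}" "\<forall>i. Suc i < 5 \<longrightarrow> {f i, f (Suc i)} \<in> E"
      unfolding copies_path_graph_iff by (elim exE conjE)
    have "{f 0, f 1} \<in> E" "{f 1, f 2} \<in> E" "{f 2, f 3} \<in> E" "{f 3, f 4} \<in> E"
      using f(2)[rule_format, of 0] f(2)[rule_format, of 1] f(2)[rule_format, of 2]
        f(2)[rule_format, of 3] by (simp_all add: numeral_eq_Suc)
    moreover have "distinct [f 0, f 1, f 2, f 3, f 4]"
      by (simp add: inj_on_eq_iff[OF f(1)])
    ultimately show False
      using P5_freeD[OF r] by blast
  qed
qed

lemma finite_copies: "finite V \<Longrightarrow> finite E \<Longrightarrow> finite (copies H (V, E))"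
  by (rule finite_subset[of _ "Pow V \<times> Pow E"]) (auto simp: copies_def subgraph_def)

section \<open>Strategies of the two players as invariants\<close>

lemma score_mono:
  assumes "C \<subseteq> C'" "finite C'"
  shows "score n H C \<le> score n H C'"
  unfolding score_def
proof (rule card_mono)
  show "finite (copies H ({..<n}, C'))"
    by (rule finite_copies) (use assms in auto)
  show "copies H ({..<n}, C) \<subseteq> copies H ({..<n}, C')"
    using assms by (auto simp: copies_def subgraph_def)
qed

lemma finite_constructor_moves: "finite (constructor_moves n F C B)"
  by (rule finite_subset[OF _ finite_unclaimed]) (auto simp: constructor_moves_def)

text \<open>Constructor's graph only grows, so a score once reached is kept.\<close>

lemma score_le_game_value:
  assumes "finite C"
  shows "score n H C \<le> game_value n H F p C B"
  using assms
proof (induction "card (unclaimed n C B)" arbitrary: p C B rule: less_induct)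
  case less
  show ?case
  proof (cases "game_over n F C B")
    case True
    then show ?thesis by (subst game_value.simps) simp
  next
    case False
    then have ne: "constructor_moves n F C B \<noteq> {}" "unclaimed n C B \<noteq> {}"
      by (auto simp: game_over_def)
    show ?thesis
    proof (cases p)
      case Constructor
      obtain e where e: "e \<in> constructor_moves n F C B"
        using ne by blast
      then have "unclaimed n (insert e C) B \<subset> unclaimed n C B"
        by (auto simp: constructor_moves_def unclaimed_def)
      then have "score n H (insert e C) \<le> game_value n H F Blocker (insert e C) B"
        using less by (simp add: psubset_card_mono finite_unclaimed)
      moreover have "score n H C \<le> score n H (insert e C)"
        using less.prems by (intro score_mono) auto
      moreover have "game_value n H F Blocker (insert e C) B \<le> game_value n H F p C B"
        using False e Constructor
        by (subst (2) game_value.simps) (simp add: finite_constructor_moves)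
      ultimately show ?thesis
        by simp
    next
      case Blocker
      have "score n H C \<le> game_value n H F Constructor C (insert e B)"
        if "e \<in> unclaimed n C B" for e
      proof -
        have "unclaimed n C (insert e B) \<subset> unclaimed n C B"
          using that by (auto simp: unclaimed_def)
        then show ?thesis
          using less by (simp add: psubset_card_mono finite_unclaimed)
      qed
      then show ?thesis
        using False ne Blocker
        by (subst game_value.simps) (simp add: finite_unclaimed)
    qed
  qed
qed

text \<open>\<open>I\<close> encodes a strategy of Blocker: it holds at Constructor's turns, and
  Blocker can restore it after each edge of Constructor unless the board is full.\<close>

lemma game_value_Constructor_le:
  assumes inv: "I C B"
    and score: "\<And>C B. I C B \<Longrightarrow> score n H C \<le> s"
    and step: "\<And>C B e. I C B \<Longrightarrow> e \<in> constructor_moves n F C B \<Longrightarrow>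
      I (insert e C) B \<and> unclaimed n (insert e C) B = {} \<or>
      (\<exists>f\<in>unclaimed n (insert e C) B. I (insert e C) (insert f B))"
  shows "game_value n H F Constructor C B \<le> s"
  using inv
proof (induction "card (unclaimed n C B)" arbitrary: C B rule: less_induct)
  case less
  show ?case
  proof (cases "game_over n F C B")
    case True
    then show ?thesis
      using score[OF less.prems] by (subst game_value.simps) simp
  next
    case False
    have "game_value n H F Blocker (insert e C) B \<le> s" if e: "e \<in> constructor_moves n F C B" for e
    proof (cases "game_over n F (insert e C) B")
      case True
      \<comment> \<open>The invariant may be known only after a further edge of Blocker, but the
        score depends on Constructor's edges alone.\<close>
      then show ?thesis
        using step[OF less.prems e] score[of "insert e C"]
        by (subst game_value.simps) auto
    next
      case nover: False
      then obtain f where f: "f \<in> unclaimed n (insert e C) B" "I (insert e C) (insert f B)"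
        using step[OF less.prems e] by (auto simp: game_over_def)
      have "unclaimed n (insert e C) (insert f B) \<subset> unclaimed n C B"
        using f e by (auto simp: unclaimed_def constructor_moves_def)
      then have "game_value n H F Constructor (insert e C) (insert f B) \<le> s"
        using less.hyps f(2) by (simp add: psubset_card_mono finite_unclaimed)
      moreover have "game_value n H F Blocker (insert e C) B
          \<le> game_value n H F Constructor (insert e C) (insert f B)"
        using nover f(1) by (subst game_value.simps) (simp add: finite_unclaimed)
      ultimately show ?thesis
        by simp
    qed
    moreover have "constructor_moves n F C B \<noteq> {}"
      using False by (auto simp: game_over_def)
    ultimately show ?thesis
      using False by (subst game_value.simps) (simp add: finite_constructor_moves)
  qed
qed

text \<open>\<open>I\<close> encodes a strategy of Constructor at Blocker's turns. It may end as
  soon as the target \<open>s\<close> is reached, because the score cannot drop afterwards.\<close>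

lemma game_value_Blocker_ge:
  assumes inv: "I C B"
    and fin: "finite C"
    and step: "\<And>C B. I C B \<Longrightarrow> s \<le> score n H C \<or> unclaimed n C B \<noteq> {} \<and>
      (\<forall>f\<in>unclaimed n C B. \<exists>e\<in>constructor_moves n F C (insert f B). I (insert e C) (insert f B))"
  shows "s \<le> game_value n H F Blocker C B"
  using inv fin
proof (induction "card (unclaimed n C B)" arbitrary: C B rule: less_induct)
  case less
  show ?case
  proof (cases "s \<le> score n H C")
    case True
    then show ?thesis
      using score_le_game_value[OF less.prems(2), of n H F Blocker B] by simp
  next
    case False
    then have ne: "unclaimed n C B \<noteq> {}"
      and st: "\<And>f. f \<in> unclaimed n C B \<Longrightarrow>
        \<exists>e\<in>constructor_moves n F C (insert f B). I (insert e C) (insert f B)"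
      using step[OF less.prems(1)] by auto
    \<comment> \<open>A reply that is legal after some edge of Blocker was legal before it as well,
      so the game is not over.\<close>
    have "constructor_moves n F C B \<noteq> {}"
      using ne st by (fastforce simp: constructor_moves_def unclaimed_def)
    then have nover: "\<not> game_over n F C B"
      using ne by (simp add: game_over_def)
    have "s \<le> game_value n H F Constructor C (insert f B)" if f: "f \<in> unclaimed n C B" for f
    proof -
      obtain e where e: "e \<in> constructor_moves n F C (insert f B)" "I (insert e C) (insert f B)"
        using st[OF f] by blast
      have eu: "e \<in> unclaimed n C (insert f B)"
        using e by (simp add: constructor_moves_def)
      have "unclaimed n (insert e C) (insert f B) \<subset> unclaimed n C B"
        using eu f by (auto simp: unclaimed_def)
      then have "s \<le> game_value n H F Blocker (insert e C) (insert f B)"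
        using less e by (simp add: psubset_card_mono finite_unclaimed)
      also have "\<dots> \<le> game_value n H F Constructor C (insert f B)"
        using e(1) eu by (subst (2) game_value.simps)
          (auto simp: game_over_def finite_constructor_moves)
      finally show ?thesis .
    qed
    then show ?thesis
      using nover ne by (subst game_value.simps) (simp add: finite_unclaimed)
  qed
qed


section \<open>Graphs without a path on five vertices\<close>

definition nbrs :: "'a set set \<Rightarrow> 'a \<Rightarrow> 'a set" where
  "nbrs E u = {w. {u, w} \<in> E}"

abbreviation deg :: "'a set set \<Rightarrow> 'a \<Rightarrow> nat" where
  "deg E u \<equiv> card (nbrs E u)"

abbreviation graph_on :: "nat \<Rightarrow> nat set set \<Rightarrow> bool" where
  "graph_on n E \<equiv> E \<subseteq> edges (complete_graph n)"

lemma mem_nbrs_iff: "w \<in> nbrs E u \<longleftrightarrow> {u, w} \<in> E"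
  by (simp add: nbrs_def)

lemma nbrs_sym: "w \<in> nbrs E u \<longleftrightarrow> u \<in> nbrs E w"
  by (simp add: nbrs_def insert_commute)

lemma graph_on_edgeD: "graph_on n E \<Longrightarrow> {u, v} \<in> E \<Longrightarrow> u < n \<and> v < n \<and> u \<noteq> v"
  using pair_edge_iff by blast

lemma nbrs_subset: "graph_on n E \<Longrightarrow> nbrs E u \<subseteq> {..<n} - {u}"
  by (auto simp: nbrs_def dest!: graph_on_edgeD)

lemma finite_nbrs: "graph_on n E \<Longrightarrow> finite (nbrs E u)"
  by (rule finite_subset[OF nbrs_subset]) auto

lemma nbrs_mono: "E \<subseteq> E' \<Longrightarrow> nbrs E u \<subseteq> nbrs E' u"
  by (auto simp: nbrs_def)

lemma deg_mono: "E \<subseteq> E' \<Longrightarrow> graph_on n E' \<Longrightarrow> deg E u \<le> deg E' u"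
  by (intro card_mono finite_nbrs nbrs_mono)

lemma deg_pos_imp_less:
  assumes "graph_on n E" "0 < deg E u"
  shows "u < n"
proof -
  obtain w where "{u, w} \<in> E"
    using assms(2) by (auto simp: card_gt_0_iff nbrs_def)
  then show ?thesis
    using graph_on_edgeD[OF assms(1)] by blast
qed

lemma ex_fresh:
  assumes "finite S" "card S < card A"
  shows "\<exists>z\<in>A. z \<notin> S"
proof (rule ccontr)
  assume "\<not> ?thesis"
  then have "A \<subseteq> S" by blast
  then have "card A \<le> card S"
    using assms(1) by (intro card_mono)
  then show False
    using assms(2) by simp
qed

lemma card_insert_insert_singleton_le: "card {a, b, c} \<le> 3"
  by (simp add: card_insert_if)

text \<open>Further neighbours of \<open>v\<close> and \<open>w\<close> would extend
  \<open>v u w\<close> to a path on five vertices, so two non-leaf neighbours of \<open>u\<close>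
  can only form a triangle with it. The degree of \<open>u\<close> provides a neighbour outside any
  three given vertices.\<close>

lemma P5_free_nbrs_deg_ge_2:
  assumes E: "graph_on n E" "P5_free E"
    and u: "4 \<le> deg E u"
    and v: "v \<in> nbrs E u" "2 \<le> deg E v"
    and w: "w \<in> nbrs E u" "2 \<le> deg E w"
    and "v \<noteq> w"
  shows "w \<in> nbrs E v \<and> deg E v \<le> 2"
proof -
  have ne: "a \<noteq> b" if "{a, b} \<in> E" for a b
    using graph_on_edgeD[OF E(1) that] by simp
  note [simp] = insert_commute
  have uv: "{u, v} \<in> E" "{v, u} \<in> E" "{u, w} \<in> E" "{w, u} \<in> E" "u \<noteq> v" "u \<noteq> w"
    using v w ne by (auto simp: nbrs_def)
  have adj: "w \<in> nbrs E v"
  proof (rule ccontr)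
    assume vw: "w \<notin> nbrs E v"
    obtain y1 where y1: "y1 \<in> nbrs E v" "y1 \<notin> {u}"
      using ex_fresh[of "{u}" "nbrs E v"] v by auto
    obtain y2 where y2: "y2 \<in> nbrs E w" "y2 \<notin> {u}"
      using ex_fresh[of "{u}" "nbrs E w"] w by auto
    have y: "{y1, v} \<in> E" "{w, y2} \<in> E" "y1 \<noteq> v" "y2 \<noteq> w" "y1 \<noteq> w" "y2 \<noteq> v" "y1 \<noteq> u" "y2 \<noteq> u"
      using y1 y2 vw ne by (auto simp: nbrs_def)
    show False
    proof (cases "y1 = y2")
      case False
      then show False
        using P5_freeD[OF E(2), of y1 v u w y2] y uv \<open>v \<noteq> w\<close> by auto
    next
      \<comment> \<open>Now \<open>u v y1 w\<close> is a 4-cycle, and a further neighbour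
        \<open>z\<close> of \<open>u\<close> starts the path \<open>z u v y1 w\<close>.\<close>
      case True
      have "card {v, w, y1} < card (nbrs E u)"
        using u card_insert_insert_singleton_le[of v w y1] by linarith
      then obtain z where z: "z \<in> nbrs E u" "z \<notin> {v, w, y1}"
        using ex_fresh[of "{v, w, y1}" "nbrs E u"] by auto
      then have "{z, u} \<in> E" "z \<noteq> u"
        using ne by (auto simp: nbrs_def)
      then show False
        using P5_freeD[OF E(2), of z u v y1 w] y uv z True \<open>v \<noteq> w\<close> by auto
    qed
  qed
  moreover have "deg E v \<le> 2"
  proof (rule ccontr)
    assume "\<not> deg E v \<le> 2"
    \<comment> \<open>A third neighbour \<open>y\<close> of \<open>v\<close> leads to the path
      \<open>y v w u z\<close>.\<close>
    then have "card {u, w} < card (nbrs E v)"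
      using uv by simp
    then obtain y where y: "y \<in> nbrs E v" "y \<notin> {u, w}"
      using ex_fresh[of "{u, w}" "nbrs E v"] by auto
    have "card {v, w, y} < card (nbrs E u)"
      using u card_insert_insert_singleton_le[of v w y] by linarith
    then obtain z where z: "z \<in> nbrs E u" "z \<notin> {v, w, y}"
      using ex_fresh[of "{v, w, y}" "nbrs E u"] by auto
    have "{y, v} \<in> E" "{v, w} \<in> E" "{u, z} \<in> E" "y \<noteq> v" "z \<noteq> u"
      using y z adj ne by (auto simp: nbrs_def)
    then show False
      using P5_freeD[OF E(2), of y v w u z] uv y z \<open>v \<noteq> w\<close> by auto
  qed
  ultimately show ?thesis ..
qed

text \<open>Degree three at \<open>v\<close> excludes the triangle. Hence the centre of a large star
  has at most one neighbour that is itself such a centre, and apart from it only leaves.\<close>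

lemma P5_free_unique_nbr:
  assumes "graph_on n E" "P5_free E" "4 \<le> deg E u"
    and "v \<in> nbrs E u" "3 \<le> deg E v" "w \<in> nbrs E u" "2 \<le> deg E w"
  shows "v = w"
proof (rule ccontr)
  assume "v \<noteq> w"
  then have "deg E v \<le> 2"
    using P5_free_nbrs_deg_ge_2[OF assms(1-4) _ assms(6,7)] assms(5) by simp
  then show False
    using assms(5) by simp
qed

text \<open>All non-leaf neighbours other than a chosen \<open>v\<close> lie among the at most two
  neighbours of \<open>v\<close>, one of which is \<open>u\<close>.\<close>

lemma P5_free_card_nonleaf_nbrs:
  assumes E: "graph_on n E" "P5_free E" and u: "4 \<le> deg E u"
  shows "card {v \<in> nbrs E u. 2 \<le> deg E v} \<le> 2"
proof (rule ccontr)
  let ?N = "{v \<in> nbrs E u. 2 \<le> deg E v}"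
  assume "\<not> card ?N \<le> 2"
  then have c: "3 \<le> card ?N" by simp
  have "?N \<noteq> {}"
    using c by (metis card.empty not_numeral_le_zero)
  then obtain v where v: "v \<in> ?N"
    by blast
  have N: "w \<in> nbrs E v \<and> deg E v \<le> 2" if "w \<in> ?N" "w \<noteq> v" for w
    using P5_free_nbrs_deg_ge_2[OF E u, of v w] v that by simp
  then have "?N \<subseteq> insert v (nbrs E v)" "deg E v \<le> 2 \<or> ?N \<subseteq> {v}"
    by blast+
  moreover have "\<not> ?N \<subseteq> {v}"
    using c card_mono[of "{v}" ?N] by auto
  ultimately have v2: "?N \<subseteq> insert v (nbrs E v)" "deg E v \<le> 2"
    by auto
  have "u \<in> nbrs E v" "u \<notin> ?N" "v \<notin> nbrs E v"
    using v nbrs_sym[of v E u] nbrs_subset[OF E(1), of u] nbrs_subset[OF E(1), of v] by auto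
  then have "?N \<subseteq> insert v (nbrs E v - {u})" "card (insert v (nbrs E v - {u})) \<le> 2"
    using v2 finite_nbrs[OF E(1), of v] by (auto simp: card_insert_if)
  moreover have "finite (insert v (nbrs E v - {u}))"
    using finite_nbrs[OF E(1), of v] by simp
  ultimately have "card ?N \<le> 2"
    by (meson card_mono le_trans)
  then show False
    using c by simp
qed

text \<open>From degree four on at most two neighbours are not leaves; the constant 4 covers the
  vertices of smaller degree.\<close>

lemma P5_free_deg_le:
  assumes E: "graph_on n E" "P5_free E"
  shows "deg E u \<le> 4 + card {v \<in> nbrs E u. deg E v = 1}"
proof (cases "4 \<le> deg E u")
  case True
  have pos: "deg E v > 0" if "v \<in> nbrs E u" for v
    using that nbrs_sym[of v E u] finite_nbrs[OF E(1), of v] card_gt_0_iff by blast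
  have "nbrs E u = {v \<in> nbrs E u. deg E v = 1} \<union> {v \<in> nbrs E u. 2 \<le> deg E v}"
  proof -
    have "deg E v = 1 \<or> 2 \<le> deg E v" if "v \<in> nbrs E u" for v
      using pos[OF that] by linarith
    then show ?thesis by blast
  qed
  then have "deg E u \<le> card {v \<in> nbrs E u. deg E v = 1} + card {v \<in> nbrs E u. 2 \<le> deg E v}"
    using card_Un_le[of "{v \<in> nbrs E u. deg E v = 1}" "{v \<in> nbrs E u. 2 \<le> deg E v}"] by argo
  then show ?thesis
    using P5_free_card_nonleaf_nbrs[OF E True] by simp
qed simp

text \<open>A vertex of degree one is a neighbour of only one \<open>u\<close>, so the counted sets
  are disjoint.\<close>

lemma sum_leaf_nbrs_le:
  assumes E: "graph_on n E" and "finite U"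
  shows "(\<Sum>u\<in>U. card {v \<in> nbrs E u. deg E v = 1}) \<le> n"
proof -
  have "(\<Sum>u\<in>U. card {v \<in> nbrs E u. deg E v = 1}) =
      card (\<Union>u\<in>U. {v \<in> nbrs E u. deg E v = 1})"
  proof (rule card_UN_disjoint[symmetric])
    show "\<forall>i\<in>U. \<forall>j\<in>U. i \<noteq> j \<longrightarrow>
        {v \<in> nbrs E i. deg E v = 1} \<inter> {v \<in> nbrs E j. deg E v = 1} = {}"
    proof (clarify, rule ccontr)
      fix i j
      assume "i \<noteq> j" "{v \<in> nbrs E i. deg E v = 1} \<inter> {v \<in> nbrs E j. deg E v = 1} \<noteq> {}"
      then obtain v where v: "v \<in> nbrs E i" "v \<in> nbrs E j" "deg E v = 1"
        by blast
      then have "i \<in> nbrs E v" "j \<in> nbrs E v"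
        by (simp_all add: nbrs_sym[of _ E v])
      then show False
        using \<open>i \<noteq> j\<close> v(3) by (metis card_1_singletonE singletonD)
    qed
  qed (use assms finite_nbrs[OF E] in auto)
  also have "\<dots> \<le> card {..<n}"
    using nbrs_subset[OF E] by (intro card_mono) auto
  finally show ?thesis by simp
qed

lemma P5_free_sum_deg_le:
  assumes E: "graph_on n E" "P5_free E"
  shows "(\<Sum>u<n. deg E u) \<le> 5 * n"
proof -
  have "(\<Sum>u<n. deg E u) \<le> (\<Sum>u<n. 4 + card {v \<in> nbrs E u. deg E v = 1})"
    by (intro sum_mono P5_free_deg_le[OF E])
  also have "\<dots> = 4 * n + (\<Sum>u<n. card {v \<in> nbrs E u. deg E v = 1})"
    by (simp add: sum.distrib del: One_nat_def)
  also have "\<dots> \<le> 5 * n"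
    using sum_leaf_nbrs_le[OF E(1), of "{..<n}"] by simp
  finally show ?thesis .
qed

text \<open>The linear degree sum limits the number of large stars; for \<open>k\<close> of order
  \<open>sqrt n\<close> there are only of order \<open>sqrt n\<close> of them.\<close>

lemma P5_free_card_big_le:
  assumes E: "graph_on n E" "P5_free E" and "0 < k"
  shows "card {u. k \<le> deg E u} \<le> 5 * n div k"
proof -
  have sub: "{u. k \<le> deg E u} \<subseteq> {..<n}"
  proof
    fix u
    assume "u \<in> {u. k \<le> deg E u}"
    then have "0 < deg E u"
      using \<open>0 < k\<close> by simp
    then show "u \<in> {..<n}"
      using deg_pos_imp_less[OF E(1)] by simp
  qed
  have "card {u. k \<le> deg E u} * k = (\<Sum>u | k \<le> deg E u. k)"
    by simp
  also have "\<dots> \<le> (\<Sum>u | k \<le> deg E u. deg E u)"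
    by (rule sum_mono) simp
  also have "\<dots> \<le> (\<Sum>u<n. deg E u)"
    using sub by (intro sum_mono2) auto
  also have "\<dots> \<le> 5 * n"
    by (rule P5_free_sum_deg_le[OF E])
  finally show ?thesis
    using \<open>0 < k\<close> by (simp add: less_eq_div_iff_mult_less_eq)
qed


section \<open>Blocker's strategy\<close>

text \<open>The weights are chosen such that an edge of Constructor at \<open>u\<close> or \<open>v\<close> raises the potential by at
  most one, an edge of Blocker never raises it, and at the end it is at least three times the number
  of leaves at \<open>u\<close> plus twice the number of leaves at \<open>v\<close>.\<close>

definition load :: "nat set set \<Rightarrow> nat set set \<Rightarrow> nat \<Rightarrow> nat \<Rightarrow> nat \<Rightarrow> nat" where
  "load C B u v w =
     (if {u, w} \<in> C then 3 else if {u, w} \<notin> B then 2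
      else if {v, w} \<in> C then 2 else if {v, w} \<in> B then 0 else 1)"

definition potential :: "nat \<Rightarrow> nat set set \<Rightarrow> nat set set \<Rightarrow> nat \<Rightarrow> nat \<Rightarrow> nat" where
  "potential n C B u v = (\<Sum>w\<in>{..<n} - {u, v}. load C B u v w)"

text \<open>No edge of Blocker lowers the potential; since \<open>u\<close> and \<open>v\<close> cannot get a common neighbour, no edge
  of Constructor can then raise it either.\<close>

definition frozen :: "nat \<Rightarrow> nat set set \<Rightarrow> nat set set \<Rightarrow> nat \<Rightarrow> nat \<Rightarrow> bool" where
  "frozen n C B u v \<longleftrightarrow>
     (\<forall>w\<in>{..<n} - {u, v}. {u, w} \<in> C \<or> {v, w} \<in> C \<or> {u, w} \<in> B \<and> {v, w} \<in> B)"

definition big :: "nat \<Rightarrow> nat set set \<Rightarrow> nat set" where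
  "big k C = {u. k \<le> deg C u}"

text \<open>Large centres not yet joined to another large centre; Blocker has to guard them in case
  they are joined later.\<close>

definition lonely :: "nat \<Rightarrow> nat set set \<Rightarrow> nat \<Rightarrow> bool" where
  "lonely k C u \<longleftrightarrow> u \<in> big k C \<and> nbrs C u \<inter> big k C = {}"

definition exhausted :: "nat \<Rightarrow> nat set set \<Rightarrow> nat set set \<Rightarrow> nat \<Rightarrow> bool" where
  "exhausted n C B u \<longleftrightarrow> (\<forall>w<n. w \<noteq> u \<longrightarrow> {u, w} \<in> C \<union> B)"

text \<open>Blocker matches the degree of \<open>u\<close> from \<open>k\<close> on. One unit more
  is tolerated once all edges at \<open>u\<close> are claimed: no answer at \<open>u\<close> is
  left, but no further edge can arrive either.\<close>

definition lonely_ok :: "nat \<Rightarrow> nat \<Rightarrow> nat set set \<Rightarrow> nat set set \<Rightarrow> nat \<Rightarrow> bool" where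
  "lonely_ok n k C B u \<longleftrightarrow> deg C u \<le> deg B u + k \<or> deg C u \<le> deg B u + k + 1 \<and> exhausted n C B u"

text \<open>While two large stars can still be joined, the later one to reach degree \<open>k\<close> has received
  only answers that block edges to other large stars, of which there are few.\<close>

definition apart_ok :: "nat \<Rightarrow> nat set set \<Rightarrow> nat set set \<Rightarrow> nat \<Rightarrow> nat \<Rightarrow> bool" where
  "apart_ok k C B u v \<longleftrightarrow>
     deg C u \<le> k + card (nbrs B u \<inter> big k C) \<or> deg C v \<le> k + card (nbrs B v \<inter> big k C)"

text \<open>\<open>m\<close> is the excess allowed when the double star arises. The additional unit
  is allowed in a frozen position, where Blocker cannot lower the potential but Constructor cannot
  extend the double star either.\<close>

definition pair_ok :: "nat \<Rightarrow> nat \<Rightarrow> nat set set \<Rightarrow> nat set set \<Rightarrow> nat \<Rightarrow> nat \<Rightarrow> bool" where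
  "pair_ok n m C B u v \<longleftrightarrow>
     potential n C B u v \<le> 2 * n + m \<or> potential n C B u v \<le> 2 * n + m + 1 \<and> frozen n C B u v"

text \<open>Holds at Constructor's turns. The clauses on lonely centres prepare for the moment when
  a pair of large centres arises: they keep its initial potential small, and the last clause keeps
  it small from then on.\<close>

definition blocker_inv :: "nat \<Rightarrow> nat \<Rightarrow> nat \<Rightarrow> nat set set \<Rightarrow> nat set set \<Rightarrow> bool" where
  "blocker_inv n k m C B \<longleftrightarrow>
     graph_on n C \<and> graph_on n B \<and> C \<inter> B = {} \<and> P5_free C \<and>
     (\<forall>u. lonely k C u \<longrightarrow> lonely_ok n k C B u) \<and>
     (\<forall>u v. lonely k C u \<and> lonely k C v \<and> {u, v} \<in> unclaimed n C B \<longrightarrow> apart_ok k C B u v) \<and>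
     (\<forall>u v. {u, v} \<in> C \<and> u \<in> big k C \<and> v \<in> big k C \<longrightarrow> pair_ok n m C B u v \<or> pair_ok n m C B v u)"

lemma blocker_invI:
  assumes "graph_on n C" "graph_on n B" "C \<inter> B = {}" "P5_free C"
    and "\<And>u. lonely k C u \<Longrightarrow> lonely_ok n k C B u"
    and "\<And>u v. lonely k C u \<Longrightarrow> lonely k C v \<Longrightarrow> {u, v} \<in> unclaimed n C B \<Longrightarrow> apart_ok k C B u v"
    and "\<And>u v. {u, v} \<in> C \<Longrightarrow> u \<in> big k C \<Longrightarrow> v \<in> big k C \<Longrightarrow>
      pair_ok n m C B u v \<or> pair_ok n m C B v u"
  shows "blocker_inv n k m C B"
  using assms by (simp add: blocker_inv_def)

lemma unclaimed_iff: "e \<in> unclaimed n C B \<longleftrightarrow> e \<in> edges (complete_graph n) \<and> e \<notin> C \<and> e \<notin> B"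
  by (auto simp: unclaimed_def)

section \<open>How the potential and the invariant react to single edges\<close>

lemma card_eq_sum_indicator:
  assumes "A \<subseteq> S" "finite S"
  shows "card A = (\<Sum>w\<in>S. if w \<in> A then 1 else 0)"
proof -
  have "(\<Sum>w\<in>S. if w \<in> A then 1 else 0) = card (S \<inter> A)"
    using assms(2) by (simp flip: sum.inter_restrict)
  moreover have "S \<inter> A = A"
    using assms(1) by blast
  ultimately show ?thesis by simp
qed

text \<open>Vertex by vertex, the load of \<open>w\<close> is at most 2, plus one for each edge of
  Constructor from \<open>u\<close> or \<open>v\<close> to \<open>w\<close>, minus one if Blocker
  has \<open>{u, w}\<close>. This bounds the potential of a new pair by the imbalance at
  \<open>u\<close> and the degree of \<open>v\<close>.\<close>

lemma potential_le:
  assumes "graph_on n C" "graph_on n B" "C \<inter> B = {}" "{u, v} \<in> C"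
  shows "potential n C B u v + deg B u \<le> 2 * n + deg C u + deg C v"
proof -
  let ?S = "{..<n} - {u, v}"
  have "v \<notin> nbrs B u"
    using assms(3,4) by (auto simp: nbrs_def)
  then have B: "deg B u = (\<Sum>w\<in>?S. if w \<in> nbrs B u then 1 else 0)"
    using nbrs_subset[OF assms(2), of u] by (intro card_eq_sum_indicator) auto
  have C: "(\<Sum>w\<in>?S. if w \<in> nbrs C a then 1 else 0) \<le> deg C a" for a
  proof -
    have "(\<Sum>w\<in>?S. if w \<in> nbrs C a then 1 else 0) = card (nbrs C a \<inter> ?S)"
      by (subst card_eq_sum_indicator[of _ ?S]) (auto intro: sum.cong)
    also have "\<dots> \<le> deg C a"
      by (intro card_mono finite_nbrs[OF assms(1)]) auto
    finally show ?thesis .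
  qed
  have "potential n C B u v + deg B u = (\<Sum>w\<in>?S. load C B u v w + (if w \<in> nbrs B u then 1 else 0))"
    unfolding B potential_def by (simp add: sum.distrib)
  also have "\<dots> \<le> (\<Sum>w\<in>?S. 2 + (if w \<in> nbrs C u then 1 else 0) + (if w \<in> nbrs C v then 1 else 0))"
    using assms(3) by (intro sum_mono) (auto simp: load_def nbrs_def)
  also have "\<dots> = 2 * card ?S + (\<Sum>w\<in>?S. if w \<in> nbrs C u then 1 else 0)
      + (\<Sum>w\<in>?S. if w \<in> nbrs C v then 1 else 0)"
    by (simp only: sum.distrib sum_constant mult.commute of_nat_id)
  also have "\<dots> \<le> 2 * n + deg C u + deg C v"
    using card_mono[of "{..<n}" ?S] C[of u] C[of v] by auto
  finally show ?thesis .
qed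

lemma load_insert_Blocker_le: "f \<notin> C \<Longrightarrow> load C (insert f B) u v w \<le> load C B u v w"
  by (auto simp: load_def)

lemma potential_insert_Blocker_le:
  "f \<notin> C \<Longrightarrow> potential n C (insert f B) u v \<le> potential n C B u v"
  unfolding potential_def by (intro sum_mono load_insert_Blocker_le)

lemma frozen_insert_Blocker: "frozen n C B u v \<Longrightarrow> frozen n C (insert f B) u v"
  by (auto simp: frozen_def)

lemma pair_ok_insert_Blocker:
  assumes "f \<notin> C" "pair_ok n m C B u v"
  shows "pair_ok n m C (insert f B) u v"
  using potential_insert_Blocker_le[OF assms(1), of n B u v] frozen_insert_Blocker[of n C B u v f] assms(2)
  unfolding pair_ok_def by linarith

lemma graph_on_insert: "graph_on n B \<Longrightarrow> f \<in> unclaimed n C B' \<Longrightarrow> graph_on n (insert f B)"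
  by (simp add: unclaimed_iff)

lemma lonely_ok_insert_Blocker:
  assumes "graph_on n (insert f B)" "lonely_ok n k C B u"
  shows "lonely_ok n k C (insert f B) u"
proof -
  have "deg B u \<le> deg (insert f B) u"
    by (rule deg_mono[OF _ assms(1)]) auto
  moreover have "exhausted n C B u \<Longrightarrow> exhausted n C (insert f B) u"
    by (simp add: exhausted_def)
  ultimately show ?thesis
    using assms(2) unfolding lonely_ok_def by linarith
qed

lemma apart_ok_insert_Blocker:
  assumes "graph_on n (insert f B)" "apart_ok k C B u v"
  shows "apart_ok k C (insert f B) u v"
proof -
  have "card (nbrs B a \<inter> big k C) \<le> card (nbrs (insert f B) a \<inter> big k C)" for a
    using finite_nbrs[OF assms(1), of a] nbrs_mono[of B "insert f B" a] by (intro card_mono) auto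
  from this[of u] this[of v] show ?thesis
    using assms(2) unfolding apart_ok_def by linarith
qed

lemma blocker_inv_insert_Blocker:
  assumes "blocker_inv n k m C B" "f \<in> unclaimed n C B"
  shows "blocker_inv n k m C (insert f B)"
proof -
  have f: "f \<notin> C" "graph_on n (insert f B)"
    using assms by (simp_all add: unclaimed_iff blocker_inv_def)
  have sub: "e \<in> unclaimed n C B" if "e \<in> unclaimed n C (insert f B)" for e
    using that by (simp add: unclaimed_iff)
  show ?thesis
  proof (rule blocker_invI)
    show "graph_on n C" "C \<inter> insert f B = {}" "P5_free C"
      using assms(1) f(1) by (simp_all add: blocker_inv_def)
    show "lonely_ok n k C (insert f B) u" if "lonely k C u" for u
      using that assms(1) by (intro lonely_ok_insert_Blocker f) (simp add: blocker_inv_def)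
    show "apart_ok k C (insert f B) u v"
      if "lonely k C u" "lonely k C v" "{u, v} \<in> unclaimed n C (insert f B)" for u v
      using that(1,2) sub[OF that(3)] assms(1)
      by (intro apart_ok_insert_Blocker[OF f(2)]) (simp add: blocker_inv_def)
    show "pair_ok n m C (insert f B) u v \<or> pair_ok n m C (insert f B) v u"
      if "{u, v} \<in> C" "u \<in> big k C" "v \<in> big k C" for u v
      using that assms(1) pair_ok_insert_Blocker[OF f(1)] unfolding blocker_inv_def by blast
  qed (rule f)
qed

text \<open>Blocker takes a vertex \<open>w\<close> away from \<open>u\<close> first and from
  \<open>v\<close> afterwards; its load falls from 2 to at most 1 and then to 0.\<close>

lemma ex_potential_lowering_move:
  assumes "\<not> frozen n C B u v" "u < n" "v < n"
  obtains f where "f \<in> unclaimed n C B" "potential n C (insert f B) u v < potential n C B u v"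
proof -
  obtain w where w: "w \<in> {..<n} - {u, v}" "{u, w} \<notin> C" "{v, w} \<notin> C" "\<not> ({u, w} \<in> B \<and> {v, w} \<in> B)"
    using assms(1) by (auto simp: frozen_def)
  define f where "f = (if {u, w} \<in> B then {v, w} else {u, w})"
  have f: "f \<in> unclaimed n C B" "f \<notin> C"
    using w assms(2,3) by (auto simp: f_def unclaimed_iff pair_edge_iff)
  have "load C (insert f B) u v w < load C B u v w"
    using w by (auto simp: load_def f_def doubleton_eq_iff)
  then have "potential n C (insert f B) u v < potential n C B u v"
    unfolding potential_def using w(1) load_insert_Blocker_le[OF f(2)]
    by (intro sum_strict_mono_ex1) auto
  then show ?thesis
    using f that by blast
qed

lemma nbrs_insert_other: "u \<notin> e \<Longrightarrow> nbrs (insert e C) u = nbrs C u"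
  by (auto simp: nbrs_def)

lemma nbrs_insert_end: "nbrs (insert {x, y} C) x = insert y (nbrs C x)"
  by (auto simp: nbrs_def doubleton_eq_iff)

lemma deg_insert_end:
  assumes "graph_on n C" "{x, y} \<notin> C"
  shows "deg (insert {x, y} C) x = Suc (deg C x)"
  using assms finite_nbrs[OF assms(1), of x] by (simp add: nbrs_insert_end mem_nbrs_iff)

text \<open>A common neighbour would be a second non-leaf neighbour of \<open>u\<close> besides
  \<open>v\<close>.\<close>

lemma P5_free_pair_no_common_nbr:
  assumes "graph_on n C" "P5_free C" "4 \<le> deg C u" "3 \<le> deg C v" "{u, v} \<in> C"
    and "{u, y} \<in> C" "{v, y} \<in> C"
  shows False
proof -
  have "u \<noteq> v" "y \<noteq> v"
    using graph_on_edgeD[OF assms(1)] assms(5,7) by blast+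
  have "{u, v} \<subseteq> nbrs C y"
    using assms(6,7) by (simp add: nbrs_def insert_commute)
  then have "2 \<le> deg C y"
    using card_mono[OF finite_nbrs[OF assms(1)], of "{u, v}" y] \<open>u \<noteq> v\<close> by simp
  then show False
    using P5_free_unique_nbr[OF assms(1-3), of v y] assms \<open>y \<noteq> v\<close> by (simp add: mem_nbrs_iff)
qed

text \<open>The new edge changes only the load of \<open>y\<close>, by at most one, and Blocker
  takes this back at once unless the position has become frozen.\<close>

lemma pair_ok_Constructor_move:
  assumes C': "graph_on n (insert e C)" "P5_free (insert e C)"
    and e: "e = {u, y} \<or> e = {v, y}" "y \<noteq> u" "y \<noteq> v" "e \<notin> C" "e \<notin> B"
    and uv: "{u, v} \<in> C" "4 \<le> deg C u" "3 \<le> deg C v"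
    and ok: "pair_ok n m C B u v"
  shows "pair_ok n m (insert e C) B u v \<or>
    (\<exists>f\<in>unclaimed n (insert e C) B. pair_ok n m (insert e C) (insert f B) u v)"
proof -
  have lt: "u < n" "v < n" "u \<noteq> v"
    using graph_on_edgeD[OF C'(1)] uv(1) by blast+
  have "y < n"
    using graph_on_edgeD[OF C'(1)] e(1) by blast
  have deg: "4 \<le> deg (insert e C) u" "3 \<le> deg (insert e C) v"
    using deg_mono[OF subset_insertI C'(1)] uv(2,3) le_trans by blast+
  \<comment> \<open>In a frozen position \<open>y\<close> would already be attached to the other
    centre, because \<open>e\<close> was unclaimed; the new edge would make it a common
    neighbour.\<close>
  have "\<not> frozen n C B u v"
  proof
    assume "frozen n C B u v"
    then have "{u, y} \<in> C \<or> {v, y} \<in> C \<or> {u, y} \<in> B \<and> {v, y} \<in> B"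
      using \<open>y < n\<close> e(2,3) by (simp add: frozen_def)
    then have "{u, y} \<in> insert e C" "{v, y} \<in> insert e C"
      using e by auto
    then show False
      using P5_free_pair_no_common_nbr[OF C' deg] uv(1) by blast
  qed
  then have pot: "potential n C B u v \<le> 2 * n + m"
    using ok by (simp add: pair_ok_def)
  have "load (insert e C) B u v w \<le> load C B u v w + (if w = y then 1 else 0)" for w
  proof (cases "w = y")
    case True
    have "{u, y} \<noteq> {v, y}"
      using lt(3) e(2,3) by (simp add: doubleton_eq_iff)
    then show ?thesis
      using True e by (elim disjE) (simp_all add: load_def)
  next
    case False
    then have "{u, w} \<noteq> e" "{v, w} \<noteq> e"
      using e(1-3) lt(3) by (auto simp: doubleton_eq_iff)
    then show ?thesis
      by (simp add: load_def)
  qed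
  then have "potential n (insert e C) B u v \<le>
      (\<Sum>w\<in>{..<n} - {u, v}. load C B u v w + (if w = y then 1 else 0))"
    unfolding potential_def by (intro sum_mono)
  also have "\<dots> = potential n C B u v + 1"
    using \<open>y < n\<close> e(2,3) by (simp add: sum.distrib potential_def)
  finally have pot': "potential n (insert e C) B u v \<le> 2 * n + m + 1"
    using pot by simp
  show ?thesis
  proof (cases "frozen n (insert e C) B u v")
    case True
    then show ?thesis
      using pot' by (simp add: pair_ok_def)
  next
    case False
    then obtain f where "f \<in> unclaimed n (insert e C) B"
      "potential n (insert e C) (insert f B) u v < potential n (insert e C) B u v"
      using lt by (elim ex_potential_lowering_move)
    then show ?thesis
      using pot' by (intro disjI2 bexI[of _ f]) (simp_all add: pair_ok_def)
  qed
qed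


section \<open>Blocker's reply to one edge of Constructor\<close>

lemma big_mono: "graph_on n C' \<Longrightarrow> C \<subseteq> C' \<Longrightarrow> big k C \<subseteq> big k C'"
  using deg_mono[of C C' n] by (auto simp: big_def intro: le_trans)

lemma mem_big_insert_other: "u \<notin> e \<Longrightarrow> u \<in> big k (insert e C) \<longleftrightarrow> u \<in> big k C"
  by (simp add: big_def nbrs_insert_other)

lemma lonely_of_insert:
  assumes "graph_on n (insert e C)" "lonely k (insert e C) u" "u \<in> big k C"
  shows "lonely k C u"
  using assms(2,3) big_mono[OF assms(1) subset_insertI, of k] nbrs_mono[OF subset_insertI, of C u e]
  unfolding lonely_def by blast

lemma unique_big_nbr:
  assumes "graph_on n C" "P5_free C" "4 \<le> k" "u \<in> big k C"
    and "v \<in> nbrs C u" "v \<in> big k C" "w \<in> nbrs C u" "w \<in> big k C"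
  shows "v = w"
  using assms by (intro P5_free_unique_nbr[OF assms(1,2), of u v w]) (auto simp: big_def)

context
  fixes n k m :: nat and C B :: "nat set set" and x y :: nat and C' :: "nat set set"
  assumes inv: "blocker_inv n k m C B"
    and k: "4 \<le> k" and m: "2 * k + 5 * n div k + 3 \<le> m"
    and C'_def: "C' = insert {x, y} C"
    and unclaimed: "{x, y} \<in> unclaimed n C B"
    and P5_free: "P5_free C'"
begin

lemma move_facts:
  shows "graph_on n C'" "graph_on n C" "graph_on n B" "C' \<inter> B = {}" "{x, y} \<notin> C" "{x, y} \<notin> B" "x \<noteq> y"
  using inv unclaimed by (auto simp: C'_def unclaimed_iff blocker_inv_def pair_edge_iff)

lemma big_sub: "big k C \<subseteq> big k C'"
  by (rule big_mono[OF move_facts(1)]) (auto simp: C'_def)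

text \<open>The new edge does not meet \<open>u\<close>, so its degree is unchanged, and a centre
  that is lonely now was lonely before.\<close>

lemma lonely_ok_after:
  assumes "lonely k C' u" "u \<noteq> x" "u \<noteq> y"
  shows "lonely_ok n k C' B u"
proof -
  have u: "u \<notin> {x, y}"
    using assms by simp
  then have "u \<in> big k C"
    using assms(1) mem_big_insert_other[of u "{x, y}" k C] by (simp add: lonely_def C'_def)
  then have "lonely k C u"
    using lonely_of_insert move_facts(1) assms(1) unfolding C'_def by blast
  then have "lonely_ok n k C B u"
    using inv by (simp add: blocker_inv_def)
  moreover have "exhausted n C B u \<Longrightarrow> exhausted n C' B u"
    by (simp add: exhausted_def C'_def)
  ultimately show ?thesis
    using nbrs_insert_other[OF u, of C] unfolding lonely_ok_def C'_def by auto
qed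

lemma apart_ok_after:
  assumes "lonely k C' u" "lonely k C' v" "u \<notin> {x, y}" "v \<notin> {x, y}" "{u, v} \<in> unclaimed n C' B"
  shows "apart_ok k C' B u v"
proof -
  have "u \<in> big k C" "v \<in> big k C"
    using assms mem_big_insert_other[of _ "{x, y}" k C] by (auto simp: lonely_def C'_def)
  then have "lonely k C u" "lonely k C v"
    using lonely_of_insert move_facts(1) assms(1,2) unfolding C'_def by blast+
  moreover have "{u, v} \<in> unclaimed n C B"
    using assms(5) by (simp add: unclaimed_iff C'_def)
  ultimately have ok: "apart_ok k C B u v"
    using inv by (simp add: blocker_inv_def)
  have "card (nbrs B a \<inter> big k C) \<le> card (nbrs B a \<inter> big k C')" for a
    using big_sub finite_nbrs[OF move_facts(3), of a] by (intro card_mono) auto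
  moreover have "deg C' u = deg C u" "deg C' v = deg C v"
    using assms(3,4) by (simp_all add: C'_def nbrs_insert_other)
  ultimately show ?thesis
    using ok unfolding apart_ok_def by (metis add_left_mono le_trans)
qed

lemma pair_ok_after:
  assumes "{u, v} \<in> C'" "u \<in> big k C'" "v \<in> big k C'" "u \<notin> {x, y}" "v \<notin> {x, y}"
  shows "pair_ok n m C' B u v \<or> pair_ok n m C' B v u"
proof -
  have "u \<in> big k C" "v \<in> big k C" "{u, v} \<in> C"
    using assms mem_big_insert_other[of _ "{x, y}" k C] by (auto simp: C'_def doubleton_eq_iff)
  then have ok: "pair_ok n m C B u v \<or> pair_ok n m C B v u"
    using inv by (simp add: blocker_inv_def)
  have e: "{u, w} \<in> C' \<longleftrightarrow> {u, w} \<in> C" "{v, w} \<in> C' \<longleftrightarrow> {v, w} \<in> C" for w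
    using assms(4,5) by (auto simp: C'_def doubleton_eq_iff)
  have "pair_ok n m C' B u v = pair_ok n m C B u v" "pair_ok n m C' B v u = pair_ok n m C B v u"
    unfolding pair_ok_def potential_def frozen_def load_def e by simp_all
  then show ?thesis
    using ok by simp
qed

lemma deg_end_after:
  assumes "a \<in> {x, y}"
  shows "deg C' a = Suc (deg C a)"
  using assms deg_insert_end[OF move_facts(2), of x y] deg_insert_end[OF move_facts(2), of y x]
    move_facts(5) by (auto simp: C'_def insert_commute)

text \<open>The invariant allows an excess of at most \<open>k + 1\<close> at a lonely centre, and
  the new edge adds one.\<close>

lemma deg_end_le:
  assumes "a \<in> {x, y}" "a \<in> big k C'" "nbrs C a \<inter> big k C = {}"
  shows "deg C' a \<le> deg B a + k + 2"
proof (cases "a \<in> big k C")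
  case True
  then have "lonely_ok n k C B a"
    using assms(3) inv by (simp add: lonely_def blocker_inv_def)
  then show ?thesis
    using deg_end_after[OF assms(1)] by (auto simp: lonely_ok_def)
next
  case False
  then show ?thesis
    using deg_end_after[OF assms(1)] by (simp add: big_def)
qed

text \<open>The edge joins two large centres. By uniqueness of the large neighbour neither had one
  before, so both are matched by Blocker up to a bounded excess, and \<open>apart_ok\<close> keeps
  one of the degrees close to \<open>k\<close>.\<close>

lemma pair_ok_new_edge:
  assumes big: "x \<in> big k C'" "y \<in> big k C'"
  shows "pair_ok n m C' B x y \<or> pair_ok n m C' B y x"
proof -
  have xy: "{x, y} \<in> C'" "{y, x} \<in> C'" "y \<in> nbrs C' x" "x \<in> nbrs C' y"
    by (simp_all add: C'_def nbrs_def insert_commute)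
  have lone: "nbrs C x \<inter> big k C = {}" "nbrs C y \<inter> big k C = {}"
  proof -
    have "q = y" if "q \<in> nbrs C x" "q \<in> big k C" for q
      using that big big_sub xy nbrs_mono[of C C' x]
      by (intro unique_big_nbr[OF move_facts(1) P5_free k, of x]) (auto simp: C'_def)
    then show "nbrs C x \<inter> big k C = {}"
      using move_facts(5) by (auto simp: nbrs_def)
    have "q = x" if "q \<in> nbrs C y" "q \<in> big k C" for q
      using that big big_sub xy nbrs_mono[of C C' y]
      by (intro unique_big_nbr[OF move_facts(1) P5_free k, of y]) (auto simp: C'_def)
    then show "nbrs C y \<inter> big k C = {}"
      using move_facts(5) by (auto simp: nbrs_def insert_commute)
  qed
  have bal: "deg C' x \<le> deg B x + k + 2" "deg C' y \<le> deg B y + k + 2"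
    using deg_end_le big lone by simp_all
  have K: "card (nbrs B a \<inter> big k C) \<le> 5 * n div k" for a
  proof -
    have "big k C \<subseteq> {..<n}"
      using deg_pos_imp_less[OF move_facts(2)] k by (force simp: big_def)
    then have "card (nbrs B a \<inter> big k C) \<le> card (big k C)"
      by (intro card_mono) (auto intro: finite_subset)
    also have "\<dots> \<le> 5 * n div k"
      using P5_free_card_big_le[OF move_facts(2), of k] inv k by (simp add: blocker_inv_def big_def)
    finally show ?thesis .
  qed
  have "deg C x \<le> k + 5 * n div k \<or> deg C y \<le> k + 5 * n div k"
  proof (cases "x \<in> big k C \<and> y \<in> big k C")
    case True
    then have "apart_ok k C B x y"
      using inv lone unclaimed by (simp add: blocker_inv_def lonely_def)
    then show ?thesis
      using K[of x] K[of y] by (auto simp: apart_ok_def)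
  next
    case False
    then show ?thesis
      by (auto simp: big_def)
  qed
  then have "deg C' x \<le> k + 5 * n div k + 1 \<or> deg C' y \<le> k + 5 * n div k + 1"
    using deg_end_after by auto
  \<comment> \<open>The centre of possibly high degree comes first, where Blocker's edges compensate
    for it; the other one enters with its full degree. The excesses \<open>k + 2\<close> and
    \<open>k + 5 * n div k + 1\<close> add up to the lower bound on \<open>m\<close>.\<close>
  then have "potential n C' B y x \<le> 2 * n + m \<or> potential n C' B x y \<le> 2 * n + m"
    using potential_le[OF move_facts(1,3,4) xy(1)] potential_le[OF move_facts(1,3,4) xy(2)] bal m
    by linarith
  then show ?thesis
    by (auto simp: pair_ok_def)
qed

text \<open>Here \<open>x\<close> becomes large while already attached to the large centre
  \<open>p\<close>. So far \<open>p\<close> was lonely and hence matched, and \<open>x\<close> has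
  degree at most \<open>k\<close>, so the potential is small without an answer.\<close>

lemma pair_ok_new_big:
  assumes "p \<notin> {x, y}" "{x, p} \<in> C'" "x \<in> big k C'" "p \<in> big k C'" "x \<notin> big k C"
  shows "pair_ok n m C' B p x"
proof -
  have p: "p \<in> big k C" "{p, x} \<in> C" "{p, x} \<in> C'"
    using assms mem_big_insert_other[of p "{x, y}" k C]
    by (auto simp: C'_def doubleton_eq_iff insert_commute)
  have "q = x" if "q \<in> nbrs C p" "q \<in> big k C" for q
    using that p assms big_sub nbrs_mono[of C C' p]
    by (intro unique_big_nbr[OF move_facts(1) P5_free k, of p]) (auto simp: C'_def nbrs_def)
  then have "lonely k C p"
    using p assms(5) by (auto simp: lonely_def)
  then have "lonely_ok n k C B p"
    using inv by (simp add: blocker_inv_def)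
  then have "deg C' p \<le> deg B p + k + 1"
    using nbrs_insert_other[OF assms(1), of C] by (auto simp: lonely_ok_def C'_def)
  moreover have "deg C' x \<le> k"
    using assms(5) deg_end_after[of x] by (simp add: big_def)
  ultimately show ?thesis
    using potential_le[OF move_facts(1,3,4) p(3)] m by (simp add: pair_ok_def)
qed

text \<open>The pair is new because two large centres were joined, new because \<open>x\<close>
  became large, or old. Only an old pair may call for an answer.\<close>

lemma pair_ok_Constructor_reply:
  assumes "x \<in> big k C'" "p \<in> big k C'" "{x, p} \<in> C'"
  shows "(pair_ok n m C' B x p \<or> pair_ok n m C' B p x) \<or>
    (\<exists>f\<in>unclaimed n C' B. pair_ok n m C' (insert f B) x p \<or> pair_ok n m C' (insert f B) p x)"
proof -
  consider "p = y" | "p \<notin> {x, y}" "x \<notin> big k C" | "p \<notin> {x, y}" "x \<in> big k C"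
    using graph_on_edgeD[OF move_facts(1) assms(3)] by blast
  then show ?thesis
  proof cases
    case 1
    then show ?thesis
      using pair_ok_new_edge assms by simp
  next
    case 2
    then show ?thesis
      using pair_ok_new_big assms by simp
  next
    case 3
    have p: "p \<in> big k C" "{x, p} \<in> C"
      using assms 3 mem_big_insert_other[of p "{x, y}" k C]
      by (auto simp: C'_def doubleton_eq_iff)
    then have ok: "pair_ok n m C B x p \<or> pair_ok n m C B p x"
      using inv 3(2) by (simp add: blocker_inv_def)
    have yx: "y \<noteq> x" "y \<noteq> p"
      using 3(1) move_facts(7) by auto
    have deg: "4 \<le> deg C x" "3 \<le> deg C x" "4 \<le> deg C p" "3 \<le> deg C p"
      using p 3(2) k by (auto simp: big_def)
    note * = pair_ok_Constructor_move[OF move_facts(1)[unfolded C'_def] P5_free[unfolded C'_def] _ _ _ move_facts(5,6)]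
    from ok show ?thesis
    proof
      assume "pair_ok n m C B x p"
      then show ?thesis
        using *[of x y p] yx p deg unfolding C'_def by blast
    next
      assume "pair_ok n m C B p x"
      then show ?thesis
        using *[of p y x] yx p deg unfolding C'_def by (auto simp: insert_commute)
    qed
  qed
qed

text \<open>The edge touches no lonely centre and no pair of large centres except \<open>x\<close>
  and \<open>p\<close>, so the other clauses survive and Blocker can devote the answer to this
  pair.\<close>

lemma reply_pair:
  assumes "x \<in> big k C'" "p \<in> big k C'" "{x, p} \<in> C'" "y \<in> big k C' \<Longrightarrow> p = y"
  shows "blocker_inv n k m C' B \<or> (\<exists>f\<in>unclaimed n C' B. blocker_inv n k m C' (insert f B))"
proof -
  have p: "p \<in> nbrs C' x" "x \<in> nbrs C' p"
    using assms(3) by (simp_all add: nbrs_def insert_commute)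
  have notlonely: "u \<notin> {x, y}" if "lonely k C' u" for u
    using that assms p by (auto simp: lonely_def)
  have lo: "lonely_ok n k C' B u" if "lonely k C' u" for u
    using lonely_ok_after[OF that] notlonely[OF that] by simp
  have ap: "apart_ok k C' B u v" if "lonely k C' u" "lonely k C' v" "{u, v} \<in> unclaimed n C' B" for u v
    using apart_ok_after that notlonely by simp
  have pr: "{u, v} = {x, p}" if "u \<in> {x, y} \<or> v \<in> {x, y}" "{u, v} \<in> C'" "u \<in> big k C'" "v \<in> big k C'" for u v
  proof -
    have uniq: "b = p" if "{x, b} \<in> C'" "b \<in> big k C'" for b
      using that p assms by (intro unique_big_nbr[OF move_facts(1) P5_free k, of x]) (auto simp: nbrs_def)
    have uniq': "b = x" if "{p, b} \<in> C'" "b \<in> big k C'" for b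
      using that p assms by (intro unique_big_nbr[OF move_facts(1) P5_free k, of p]) (auto simp: nbrs_def)
    have "{v, u} \<in> C'"
      using that(2) by (simp add: insert_commute)
    then show ?thesis
      using that uniq uniq' assms(4) by blast
  qed
  have po: "pair_ok n m C' (insert f B) u v \<or> pair_ok n m C' (insert f B) v u"
    if "pair_ok n m C' (insert f B) x p \<or> pair_ok n m C' (insert f B) p x" "f \<notin> C'"
      "{u, v} \<in> C'" "u \<in> big k C'" "v \<in> big k C'" for u v f
  proof (cases "u \<in> {x, y} \<or> v \<in> {x, y}")
    case True
    then show ?thesis
      using pr[OF True that(3-5)] that(1) by (auto simp: doubleton_eq_iff)
  next
    case False
    then show ?thesis
      using pair_ok_after[OF that(3-5)] pair_ok_insert_Blocker[OF that(2)] by blast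
  qed
  have po': "pair_ok n m C' B u v \<or> pair_ok n m C' B v u"
    if "pair_ok n m C' B x p \<or> pair_ok n m C' B p x"
      "{u, v} \<in> C'" "u \<in> big k C'" "v \<in> big k C'" for u v
  proof (cases "u \<in> {x, y} \<or> v \<in> {x, y}")
    case True
    then show ?thesis
      using pr[OF True that(2-4)] that(1) by (auto simp: doubleton_eq_iff)
  next
    case False
    then show ?thesis
      using pair_ok_after[OF that(2-4)] by blast
  qed
  from pair_ok_Constructor_reply[OF assms(1-3)] show ?thesis
  proof
    assume ok: "pair_ok n m C' B x p \<or> pair_ok n m C' B p x"
    have "blocker_inv n k m C' B"
      by (rule blocker_invI[OF move_facts(1,3,4) P5_free lo ap po'[OF ok]])
    then show ?thesis ..
  next
    assume "\<exists>f\<in>unclaimed n C' B. pair_ok n m C' (insert f B) x p \<or> pair_ok n m C' (insert f B) p x"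
    then obtain f where f: "f \<in> unclaimed n C' B"
      and ok: "pair_ok n m C' (insert f B) x p \<or> pair_ok n m C' (insert f B) p x"
      by blast
    have fC: "f \<notin> C'" and gr: "graph_on n (insert f B)"
      using f graph_on_insert[OF move_facts(3) f] by (simp_all add: unclaimed_iff)
    have "blocker_inv n k m C' (insert f B)"
    proof (rule blocker_invI)
      show "C' \<inter> insert f B = {}"
        using move_facts(4) fC by simp
      show "lonely_ok n k C' (insert f B) u" if "lonely k C' u" for u
        using lonely_ok_insert_Blocker[OF gr lo[OF that]] .
      show "apart_ok k C' (insert f B) u v"
        if "lonely k C' u" "lonely k C' v" "{u, v} \<in> unclaimed n C' (insert f B)" for u v
        using that by (intro apart_ok_insert_Blocker[OF gr] ap) (auto simp: unclaimed_iff)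
      show "pair_ok n m C' (insert f B) u v \<or> pair_ok n m C' (insert f B) v u"
        if "{u, v} \<in> C'" "u \<in> big k C'" "v \<in> big k C'" for u v
        by (rule po[OF ok fC that])
    qed (rule move_facts gr P5_free)+
    then show ?thesis
      using f by blast
  qed
qed

text \<open>Blocker answers at \<open>x\<close> itself, preferably by an edge to a large centre;
  this maintains the balance at \<open>x\<close> and the count in \<open>apart_ok\<close>
  together.\<close>

lemma reply_lonely:
  assumes x: "lonely k C' x" and y: "y \<notin> big k C'"
  shows "blocker_inv n k m C' B \<or> (\<exists>f\<in>unclaimed n C' B. blocker_inv n k m C' (insert f B))"
proof -
  have po: "pair_ok n m C' B u v \<or> pair_ok n m C' B v u"
    if "{u, v} \<in> C'" "u \<in> big k C'" "v \<in> big k C'" for u v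
  proof -
    have "u \<noteq> x" "v \<noteq> x"
      using that x by (auto simp: lonely_def nbrs_def insert_commute)
    then show ?thesis
      using that y by (intro pair_ok_after) auto
  qed
  have old: "x \<in> big k C \<Longrightarrow> lonely k C x"
    using lonely_of_insert move_facts(1) x unfolding C'_def by blast
  \<comment> \<open>Before the move \<open>{x, y}\<close> was unclaimed, so \<open>x\<close> was not
    exhausted and the extra unit of \<open>lonely_ok\<close> was not in use.\<close>
  have bal: "deg C' x \<le> deg B x + k + 1"
  proof (cases "x \<in> big k C")
    case True
    have "\<not> exhausted n C B x"
      using unclaimed move_facts(7) by (auto simp: exhausted_def unclaimed_iff pair_edge_iff)
    then show ?thesis
      using old[OF True] inv deg_end_after[of x] by (auto simp: blocker_inv_def lonely_ok_def)
  next
    case False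
    then show ?thesis
      using deg_end_after[of x] by (simp add: big_def)
  qed
  have lo: "lonely_ok n k C' B u" if "lonely k C' u" "u \<noteq> x" for u
    using lonely_ok_after[OF that] y that by (auto simp: lonely_def)
  have ap: "apart_ok k C' B u v"
    if "lonely k C' u" "lonely k C' v" "{u, v} \<in> unclaimed n C' B" "u \<noteq> x" "v \<noteq> x" for u v
    using that y by (intro apart_ok_after) (auto simp: lonely_def)
  have xB: "x < n"
    using graph_on_edgeD[OF move_facts(1)] by (auto simp: C'_def)
  show ?thesis
  proof (cases "exhausted n C' B x")
    case True
    have noedge: "{x, v} \<notin> unclaimed n C' B" for v
      using True by (auto simp: exhausted_def unclaimed_iff pair_edge_iff)
    have "blocker_inv n k m C' B"
    proof (rule blocker_invI)
      show "lonely_ok n k C' B u" if "lonely k C' u" for u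
        using lo[OF that] bal True by (cases "u = x") (auto simp: lonely_ok_def)
      show "apart_ok k C' B u v"
        if "lonely k C' u" "lonely k C' v" "{u, v} \<in> unclaimed n C' B" for u v
      proof -
        have "u \<noteq> x" "v \<noteq> x"
          using noedge[of v] noedge[of u] that(3) by (auto simp: insert_commute)
        then show ?thesis
          using ap[OF that] by simp
      qed
      show "pair_ok n m C' B u v \<or> pair_ok n m C' B v u"
        if "{u, v} \<in> C'" "u \<in> big k C'" "v \<in> big k C'" for u v
        by (rule po[OF that])
    qed (rule move_facts P5_free)+
    then show ?thesis ..
  next
    case False
    \<comment> \<open>A large \<open>w\<close> is chosen whenever one is available.\<close>
    obtain w where w: "{x, w} \<in> unclaimed n C' B"
      "w \<in> big k C' \<or> (\<forall>c\<in>big k C'. {x, c} \<notin> unclaimed n C' B)"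
    proof (cases "\<exists>c\<in>big k C'. {x, c} \<in> unclaimed n C' B")
      case True
      then show ?thesis
        using that by blast
    next
      case nobig: False
      obtain w where "w < n" "w \<noteq> x" "{x, w} \<notin> C' \<union> B"
        using False by (auto simp: exhausted_def)
      then have "{x, w} \<in> unclaimed n C' B"
        using xB by (simp add: unclaimed_iff pair_edge_iff)
      then show ?thesis
        using that nobig by blast
    qed
    define f where "f = {x, w}"
    have fC: "f \<notin> C'" "f \<notin> B" and gr: "graph_on n (insert f B)"
      using w(1) graph_on_insert[OF move_facts(3) w(1)] by (simp_all add: unclaimed_iff f_def)
    have wB: "w \<notin> nbrs B x" "nbrs (insert f B) x = insert w (nbrs B x)"
      using fC nbrs_insert_end[of x w B] by (simp_all add: nbrs_def f_def)
    then have degB: "deg (insert f B) x = Suc (deg B x)"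
      using finite_nbrs[OF move_facts(3), of x] by simp
    have apx: "deg C' x \<le> k + card (nbrs (insert f B) x \<inter> big k C') \<or>
        deg C' v \<le> k + card (nbrs (insert f B) v \<inter> big k C')"
      if v: "lonely k C' v" "v \<noteq> x" "{x, v} \<in> unclaimed n C' (insert f B)" for v
    proof -
      have xv: "{x, v} \<in> unclaimed n C' B" "{x, v} \<in> unclaimed n C B"
        using v(3) by (auto simp: unclaimed_iff C'_def)
      have vy: "v \<notin> {x, y}"
        using v y by (auto simp: lonely_def)
      then have vbig: "v \<in> big k C"
        using v(1) mem_big_insert_other[of v "{x, y}" k C] by (simp add: lonely_def C'_def)
      then have vl: "lonely k C v"
        using lonely_of_insert move_facts(1) v(1) unfolding C'_def by blast
      \<comment> \<open>Since \<open>v\<close> itself was available, the answer went to a large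
        centre; so the count for \<open>x\<close> grows together with its degree.\<close>
      have wbig: "w \<in> big k C'"
        using w(2) xv(1) v(1) by (auto simp: lonely_def)
      show ?thesis
      proof (cases "x \<in> big k C")
        case False
        then show ?thesis
          using deg_end_after[of x] by (simp add: big_def)
      next
        case True
        then have "apart_ok k C B x v"
          using old vl xv(2) inv by (simp add: blocker_inv_def)
        moreover have "card (nbrs (insert f B) x \<inter> big k C') = Suc (card (nbrs B x \<inter> big k C'))"
          using wB wbig finite_nbrs[OF move_facts(3), of x] by (simp add: Int_insert_left)
        moreover have "card (nbrs B x \<inter> big k C) \<le> card (nbrs B x \<inter> big k C')"
          using big_sub finite_nbrs[OF move_facts(3), of x] by (intro card_mono) auto
        moreover have "card (nbrs B v \<inter> big k C) \<le> card (nbrs (insert f B) v \<inter> big k C')"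
          using big_sub finite_nbrs[OF gr, of v] nbrs_mono[of B "insert f B" v]
          by (intro card_mono) auto
        moreover have "deg C' v = deg C v"
          using vy by (simp add: C'_def nbrs_insert_other)
        ultimately show ?thesis
          using deg_end_after[of x] unfolding apart_ok_def by simp linarith
      qed
    qed
    have "blocker_inv n k m C' (insert f B)"
    proof (rule blocker_invI)
      show "C' \<inter> insert f B = {}"
        using move_facts(4) fC by simp
      show "lonely_ok n k C' (insert f B) u" if "lonely k C' u" for u
      proof (cases "u = x")
        case True
        then show ?thesis
          using bal degB by (simp add: lonely_ok_def)
      next
        case False
        then show ?thesis
          using lonely_ok_insert_Blocker[OF gr lo[OF that]] by simp
      qed
      show "apart_ok k C' (insert f B) u v"
        if uv: "lonely k C' u" "lonely k C' v" "{u, v} \<in> unclaimed n C' (insert f B)" for u v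
      proof -
        have "u \<noteq> v"
          using uv(3) by (auto simp: unclaimed_iff pair_edge_iff)
        then consider "u \<noteq> x" "v \<noteq> x" | "u = x" "v \<noteq> x" | "v = x" "u \<noteq> x"
          by blast
        then show ?thesis
        proof cases
          case 1
          then show ?thesis
            using uv by (intro apart_ok_insert_Blocker[OF gr] ap) (auto simp: unclaimed_iff)
        next
          case 2
          then show ?thesis
            using apx[of v] uv by (simp add: apart_ok_def)
        next
          case 3
          then show ?thesis
            using apx[of u] uv by (auto simp: apart_ok_def insert_commute)
        qed
      qed
      show "pair_ok n m C' (insert f B) u v \<or> pair_ok n m C' (insert f B) v u"
        if "{u, v} \<in> C'" "u \<in> big k C'" "v \<in> big k C'" for u v
        using po[OF that] pair_ok_insert_Blocker[OF fC(1)] by blast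
    qed (rule move_facts gr P5_free)+
    then show ?thesis
      using w(1) unfolding f_def by blast
  qed
qed

lemma reply_small:
  assumes "x \<notin> big k C'" "y \<notin> big k C'"
  shows "blocker_inv n k m C' B"
proof (rule blocker_invI)
  show "lonely_ok n k C' B u" if "lonely k C' u" for u
    using that assms by (intro lonely_ok_after) (auto simp: lonely_def)
  show "apart_ok k C' B u v"
    if "lonely k C' u" "lonely k C' v" "{u, v} \<in> unclaimed n C' B" for u v
    using that assms by (intro apart_ok_after) (auto simp: lonely_def)
  show "pair_ok n m C' B u v \<or> pair_ok n m C' B v u"
    if "{u, v} \<in> C'" "u \<in> big k C'" "v \<in> big k C'" for u v
    using that assms by (intro pair_ok_after) auto
qed (rule move_facts P5_free)+

lemma reply_big:
  assumes "x \<in> big k C'"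
  shows "blocker_inv n k m C' B \<or> (\<exists>f\<in>unclaimed n C' B. blocker_inv n k m C' (insert f B))"
proof (cases "y \<in> big k C'")
  case True
  then show ?thesis
    using assms by (intro reply_pair[of y]) (auto simp: C'_def)
next
  case False
  show ?thesis
  proof (cases "lonely k C' x")
    case True
    then show ?thesis
      using False by (rule reply_lonely)
  next
    case notlonely: False
    then obtain p where "p \<in> big k C'" "{x, p} \<in> C'"
      using assms by (auto simp: lonely_def nbrs_def)
    then show ?thesis
      using assms False by (intro reply_pair[of p]) auto
  qed
qed

end

text \<open>An answer can be called for only if an endpoint of the edge is large. If none is, any
  edge of Blocker preserves the invariant.\<close>

lemma blocker_inv_step:
  assumes inv: "blocker_inv n k m C B" and k: "4 \<le> k" and m: "2 * k + 5 * n div k + 3 \<le> m"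
    and e: "e \<in> constructor_moves n (path_graph 5) C B"
  shows "blocker_inv n k m (insert e C) B \<and> unclaimed n (insert e C) B = {} \<or>
    (\<exists>f\<in>unclaimed n (insert e C) B. blocker_inv n k m (insert e C) (insert f B))"
proof -
  have eu: "e \<in> unclaimed n C B"
    using e by (simp add: constructor_moves_def)
  then have gr: "graph_on n (insert e C)"
    using inv by (simp add: unclaimed_iff blocker_inv_def)
  then have P5: "P5_free (insert e C)"
    using e copies_P5_empty_iff by (simp add: constructor_moves_def)
  obtain x y where xy: "e = {x, y}"
    using eu by (auto simp: unclaimed_iff edges_complete_graph_iff)
  have yx: "e = {y, x}"
    using xy by (simp add: insert_commute)
  have "blocker_inv n k m (insert e C) B \<or>
    (\<exists>f\<in>unclaimed n (insert e C) B. blocker_inv n k m (insert e C) (insert f B))"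
    using reply_small[OF inv k m refl, of x y] reply_big[OF inv k m refl, of x y]
      reply_big[OF inv k m refl, of y x] eu P5 unfolding xy by (auto simp: insert_commute)
  then show ?thesis
    using blocker_inv_insert_Blocker by blast
qed


section \<open>Bounding the final score\<close>

text \<open>Equality holds for \<open>a = 8N/23\<close> and \<open>b = 11N/23\<close>; the square accounts for a second, balanced
  double star on the remaining vertices.\<close>

lemma double_star_bound:
  fixes a b N :: real
  assumes "0 \<le> a" "0 \<le> b" "3 * a + 2 * b \<le> 2 * N" "a + b \<le> N" "16 / 23 * N \<le> a + b"
  shows "a * b + (N - (a + b))\<^sup>2 / 4 \<le> 4 / 23 * N\<^sup>2"
proof -
  \<comment> \<open>Half the slack in the hypothesis on \<open>3 * a + 2 * b\<close>.\<close>
  define s where "s = N - 3 / 2 * a - b"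
  have s: "0 \<le> s" "s \<le> 7 / 23 * N - a / 2" "b = N - 3 / 2 * a - s"
    using assms by (simp_all add: s_def field_simps)
  \<comment> \<open>For \<open>s\<close> at most \<open>3 * a\<close> the last term is nonpositive,
    and the quadratic in \<open>a\<close> has its maximum \<open>4/23 * N^2\<close> at
    \<open>a = 8/23 * N\<close>.\<close>
  have eq: "a * b + (N - (a + b))\<^sup>2 / 4 = a * N - 23 / 16 * a\<^sup>2 + s * (s - 3 * a) / 4"
    unfolding s(3) by (simp add: power2_eq_square field_simps)
  show ?thesis
  proof (cases "s \<le> 3 * a")
    case True
    then have "s * (s - 3 * a) \<le> 0"
      using s(1) by (simp add: mult_nonneg_nonpos)
    moreover have "a * N - 23 / 16 * a\<^sup>2 = 4 / 23 * N\<^sup>2 - 23 / 16 * (a - 8 / 23 * N)\<^sup>2"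
      by (simp add: power2_eq_square field_simps)
    ultimately show ?thesis
      unfolding eq using zero_le_power2[of "a - 8 / 23 * N"] by linarith
  next
    case False
    \<comment> \<open>A large slack and a total of at least \<open>16/23 * N\<close> force
      \<open>a\<close> to be tiny, so that crude bounds suffice.\<close>
    then have a: "a \<le> 2 / 23 * N" "s \<le> 7 / 23 * N" "0 \<le> N"
      using s(2) assms by linarith+
    have "a * N \<le> 2 / 23 * N * N" "s * s \<le> (7 / 23 * N) * (7 / 23 * N)"
      using mult_right_mono[OF a(1,3)] mult_mono[OF a(2) a(2)] a(3) s(1) by simp_all
    moreover have "s * (s - 3 * a) \<le> s * s"
      using s(1) assms(1) by (simp add: algebra_simps)
    moreover have "0 \<le> 23 / 16 * a\<^sup>2" "0 \<le> N * N"
      by simp_all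
    ultimately show ?thesis
      unfolding eq power2_eq_square[of N] by linarith
  qed
qed

lemma mult_le_quarter_square: "x * y \<le> (x + y)\<^sup>2 / 4" for x y :: real
  using zero_le_power2[of "x - y"] by (simp add: power2_eq_square field_simps)

text \<open>\<open>P\<close> contains each double star in both orders, hence the doubled constants.
  Either no size \<open>d u + d v\<close> exceeds \<open>16/23 * N\<close>, and each product is at
  most \<open>4/23 * N\<close> times the size; or one of size \<open>t\<close> does, and the others
  share the remaining \<open>N - t\<close>.\<close>

lemma double_stars_bound:
  fixes d :: "nat \<Rightarrow> real"
  assumes fin: "finite P" and sym: "\<And>u v. (u, v) \<in> P \<Longrightarrow> (v, u) \<in> P \<and> u \<noteq> v"
    and pos: "\<And>u. 0 \<le> d u"
    and pair: "\<And>u v. (u, v) \<in> P \<Longrightarrow> 3 * d u + 2 * d v \<le> 2 * N \<or> 3 * d v + 2 * d u \<le> 2 * N"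
    and total: "(\<Sum>(u, v)\<in>P. d u + d v) \<le> 2 * N"
  shows "(\<Sum>(u, v)\<in>P. d u * d v) \<le> 8 / 23 * N\<^sup>2"
proof -
  \<comment> \<open>A product is at most a quarter of the squared size, hence at most
    \<open>c / 4\<close> times a size bounded by \<open>c\<close>.\<close>
  have sum_le: "(\<Sum>(u, v)\<in>Q. d u * d v) \<le> c / 4 * (\<Sum>(u, v)\<in>Q. d u + d v)"
    if "\<And>u v. (u, v) \<in> Q \<Longrightarrow> d u + d v \<le> c" for Q c
  proof -
    have "d u * d v \<le> c / 4 * (d u + d v)" if "(u, v) \<in> Q" for u v
    proof -
      have "(d u + d v) * (d u + d v) \<le> c * (d u + d v)"
        using \<open>\<And>u v. (u, v) \<in> Q \<Longrightarrow> d u + d v \<le> c\<close>[OF that] pos[of u] pos[of v]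
        by (intro mult_right_mono) auto
      then show ?thesis
        using mult_le_quarter_square[of "d u" "d v"] by (simp add: power2_eq_square)
    qed
    then show ?thesis
      unfolding sum_distrib_left by (intro sum_mono) auto
  qed
  have N: "0 \<le> N"
  proof -
    have "0 \<le> (\<Sum>(u, v)\<in>P. d u + d v)"
      using pos by (intro sum_nonneg) auto
    then show ?thesis
      using total by simp
  qed
  show ?thesis
  proof (cases "\<forall>(u, v)\<in>P. d u + d v \<le> 16 / 23 * N")
    case True
    then have "(\<Sum>(u, v)\<in>P. d u * d v) \<le> 16 / 23 * N / 4 * (\<Sum>(u, v)\<in>P. d u + d v)"
      by (intro sum_le) auto
    also have "\<dots> \<le> 16 / 23 * N / 4 * (2 * N)"
      using total N by (intro mult_left_mono) auto
    finally show ?thesis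
      by (simp add: power2_eq_square)
  next
    case False
    then obtain u v where uv: "(u, v) \<in> P" "16 / 23 * N < d u + d v"
      by auto
    define t where "t = d u + d v"
    define Q where "Q = P - {(u, v), (v, u)}"
    have ne: "u \<noteq> v" "(v, u) \<in> P" and finQ: "finite Q"
      using sym[OF uv(1)] fin by (auto simp: Q_def)
    have split: "(\<Sum>p\<in>P. h p) = h (u, v) + h (v, u) + (\<Sum>p\<in>Q. h p)" for h :: "nat \<times> nat \<Rightarrow> real"
    proof -
      have "P = insert (u, v) (insert (v, u) Q)"
        using uv ne by (auto simp: Q_def)
      moreover have "(u, v) \<notin> insert (v, u) Q" "(v, u) \<notin> Q"
        using ne(1) by (auto simp: Q_def)
      ultimately show ?thesis
        using finQ by simp
    qed
    have Qsum: "(\<Sum>(u, v)\<in>Q. d u + d v) \<le> 2 * (N - t)"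
      using total split[of "\<lambda>(u, v). d u + d v"] by (simp add: t_def)
    \<comment> \<open>The reversed pair lies in \<open>Q\<close> too, which cancels the factor
      2.\<close>
    have Qle: "d x + d y \<le> N - t" if "(x, y) \<in> Q" for x y
    proof -
      have "(y, x) \<in> Q" "x \<noteq> y"
        using that sym[of x y] by (auto simp: Q_def)
      then have "(\<Sum>(u, v)\<in>{(x, y), (y, x)}. d u + d v) \<le> (\<Sum>(u, v)\<in>Q. d u + d v)"
        using that finQ pos by (intro sum_mono2) (auto intro: add_nonneg_nonneg)
      then show ?thesis
        using Qsum \<open>x \<noteq> y\<close> by simp
    qed
    have "0 \<le> (\<Sum>(u, v)\<in>Q. d u + d v)"
      using pos by (intro sum_nonneg) auto
    then have tN: "t \<le> N"
      using Qsum by simp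
    have "(\<Sum>(u, v)\<in>Q. d u * d v) \<le> (N - t) / 4 * (\<Sum>(u, v)\<in>Q. d u + d v)"
      using Qle by (rule sum_le)
    also have "\<dots> \<le> (N - t) / 4 * (2 * (N - t))"
      using Qsum tN by (intro mult_left_mono) auto
    also have "\<dots> = (N - t)\<^sup>2 / 2"
      by (simp add: power2_eq_square)
    finally have Qprod: "(\<Sum>(u, v)\<in>Q. d u * d v) \<le> (N - t)\<^sup>2 / 2" .
    have "d u * d v + (N - t)\<^sup>2 / 4 \<le> 4 / 23 * N\<^sup>2"
      using pair[OF uv(1)]
    proof
      assume "3 * d u + 2 * d v \<le> 2 * N"
      then show ?thesis
        using double_star_bound[of "d u" "d v" N] pos uv(2) tN by (simp add: t_def)
    next
      assume "3 * d v + 2 * d u \<le> 2 * N"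
      then show ?thesis
        using double_star_bound[of "d v" "d u" N] pos uv(2) tN by (simp add: t_def add.commute mult.commute)
    qed
    then show ?thesis
      using split[of "\<lambda>(u, v). d u * d v"] Qprod by (simp add: mult.commute)
  qed
qed

section \<open>Counting paths on four vertices by their middle edge\<close>

definition arcs :: "nat set set \<Rightarrow> (nat \<times> nat) set" where
  "arcs C = {(u, v). {u, v} \<in> C}"

lemma arcs_sigma: "graph_on n C \<Longrightarrow> arcs C = Sigma {..<n} (nbrs C)"
  using graph_on_edgeD by (auto simp: arcs_def nbrs_def)

lemma finite_arcs: "graph_on n C \<Longrightarrow> finite (arcs C)"
  by (simp add: arcs_sigma finite_nbrs)

lemma sum_swap_pairs:
  assumes "\<And>u v. (u, v) \<in> P \<Longrightarrow> (v, u) \<in> Q" "\<And>u v. (u, v) \<in> Q \<Longrightarrow> (v, u) \<in> P"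
  shows "(\<Sum>(u, v)\<in>P. h u v) = (\<Sum>(u, v)\<in>Q. h v u)"
  using assms by (intro sum.reindex_bij_witness[of _ prod.swap prod.swap]) auto

abbreviation middle_count :: "nat set set \<Rightarrow> nat \<Rightarrow> nat \<Rightarrow> nat" where
  "middle_count C u v \<equiv> (deg C u - 1) * (deg C v - 1)"

text \<open>A path on four vertices is given by its middle edge and one further edge at each end of
  it. Triangles are counted too, so only an inequality is claimed; the factor 2 comes from the two
  orientations of the middle edge.\<close>

lemma P4_copies_le:
  assumes "graph_on n C"
  shows "2 * score n (path_graph 4) C \<le> (\<Sum>(u, v)\<in>arcs C. middle_count C u v)"
proof -
  define A where "A = {(u, v) \<in> arcs C. u < v}"
  define A' where "A' = {(u, v) \<in> arcs C. v < u}"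
  define T where "T = (SIGMA p:A. (nbrs C (fst p) - {snd p}) \<times> (nbrs C (snd p) - {fst p}))"
  define \<phi> where "\<phi> = (\<lambda>((u, v), (w, z)). ({w, u, v, z}, {{w, u}, {u, v}, {v, z :: nat}}))"
  have finA: "finite A" "finite A'"
    using finite_arcs[OF assms] by (auto simp: A_def A'_def intro: finite_subset)
  have finT: "finite T"
    unfolding T_def using finA finite_nbrs[OF assms] by auto
  have four: "{..<4} = {0, 1, 2, 3::nat}"
    by auto
  have "copies (path_graph 4) ({..<n}, C) \<subseteq> \<phi> ` T"
  proof
    fix S
    assume "S \<in> copies (path_graph 4) ({..<n}, C)"
    then obtain f where f: "inj_on f {..<4}" "\<forall>i. Suc i < 4 \<longrightarrow> {f i, f (Suc i)} \<in> C"
      and S: "S = (f ` {..<4}, {{f i, f (Suc i)} |i. Suc i < 4})"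
      unfolding copies_path_graph_iff by (elim exE conjE)
    have "i = 0 \<or> i = 1 \<or> i = 2" if "Suc i < 4" for i
      using that by linarith
    then have "{{f i, f (Suc i)} |i. Suc i < 4} = {{f 0, f 1}, {f 1, f 2}, {f 2, f 3}}"
      by (auto simp: numeral_eq_Suc)
    then have S': "S = ({f 0, f 1, f 2, f 3}, {{f 0, f 1}, {f 1, f 2}, {f 2, f 3}})"
      using S by (simp add: four)
    have E: "{f 0, f 1} \<in> C" "{f 1, f 2} \<in> C" "{f 2, f 3} \<in> C"
      using f(2)[rule_format, of 0] f(2)[rule_format, of 1] f(2)[rule_format, of 2]
      by (simp_all add: numeral_eq_Suc)
    have ne: "f 0 \<noteq> f 2" "f 1 \<noteq> f 3" "f 1 \<noteq> f 2"
      by (simp_all add: inj_on_eq_iff[OF f(1)])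
    show "S \<in> \<phi> ` T"
    proof (cases "f 1 < f 2")
      case True
      then have "((f 1, f 2), (f 0, f 3)) \<in> T"
        using E ne by (auto simp: T_def A_def arcs_def nbrs_def insert_commute)
      moreover have "\<phi> ((f 1, f 2), (f 0, f 3)) = S"
        by (simp add: \<phi>_def S')
      ultimately show ?thesis
        by (metis image_eqI)
    next
      case False
      \<comment> \<open>Reading the path backwards brings the middle edge into the orientation of
        \<open>A\<close>.\<close>
      then have "((f 2, f 1), (f 3, f 0)) \<in> T"
        using E ne by (auto simp: T_def A_def arcs_def nbrs_def insert_commute)
      moreover have "\<phi> ((f 2, f 1), (f 3, f 0)) = S"
        by (simp add: \<phi>_def S' insert_commute)
      ultimately show ?thesis
        by (metis image_eqI)
    qed
  qed
  then have "score n (path_graph 4) C \<le> card T"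
    unfolding score_def using finT by (meson surj_card_le)
  also have "card T = (\<Sum>p\<in>A. card ((nbrs C (fst p) - {snd p}) \<times> (nbrs C (snd p) - {fst p})))"
    unfolding T_def using finA finite_nbrs[OF assms] by (intro card_SigmaI) auto
  also have "\<dots> = (\<Sum>(u, v)\<in>A. middle_count C u v)"
    by (intro sum.cong) (auto simp: A_def arcs_def nbrs_def card_cartesian_product insert_commute)
  finally have le: "score n (path_graph 4) C \<le> (\<Sum>(u, v)\<in>A. middle_count C u v)" .
  have "(\<Sum>(u, v)\<in>A. middle_count C u v) = (\<Sum>(u, v)\<in>A'. middle_count C v u)"
    by (rule sum_swap_pairs) (auto simp: A_def A'_def arcs_def insert_commute)
  also have "\<dots> = (\<Sum>(u, v)\<in>A'. middle_count C u v)"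
    by (simp add: mult.commute)
  finally have "2 * (\<Sum>(u, v)\<in>A. middle_count C u v) =
      (\<Sum>(u, v)\<in>A. middle_count C u v) + (\<Sum>(u, v)\<in>A'. middle_count C u v)"
    by simp
  also have "\<dots> = (\<Sum>(u, v)\<in>A \<union> A'. middle_count C u v)"
    using finA by (intro sum.union_disjoint[symmetric]) (auto simp: A_def A'_def)
  also have "A \<union> A' = arcs C"
    using graph_on_edgeD[OF assms] by (auto simp: A_def A'_def arcs_def neq_iff)
  finally show ?thesis
    using le by simp
qed

text \<open>Leaf neighbours contribute nothing. A vertex \<open>u\<close> of degree at least four
  has at most two other neighbours, each contributing at most \<open>k\<close> times the degree of
  \<open>u\<close>; smaller degrees are bounded directly, and the degree sum is linear.\<close>

lemma sum_small_arcs_le: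
  assumes C: "graph_on n C" "P5_free C" and "2 \<le> k"
  shows "(\<Sum>(u, v)\<in>arcs C. if deg C v \<le> deg C u \<and> deg C v < k then middle_count C u v else 0)
    \<le> 15 * k * n"
proof -
  let ?h = "\<lambda>u v. if deg C v \<le> deg C u \<and> deg C v < k then middle_count C u v else 0"
  have "(\<Sum>v\<in>nbrs C u. ?h u v) \<le> 3 * k * deg C u" for u
  proof (cases "4 \<le> deg C u")
    case True
    let ?N = "{v \<in> nbrs C u. 2 \<le> deg C v}"
    have "(\<Sum>v\<in>nbrs C u. ?h u v) = (\<Sum>v\<in>?N. ?h u v)"
      using finite_nbrs[OF C(1)] by (intro sum.mono_neutral_right) auto
    also have "\<dots> \<le> (\<Sum>v\<in>?N. k * deg C u)"
    proof (rule sum_mono)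
      fix v
      have "(deg C u - 1) * (deg C v - 1) \<le> deg C u * k" if "deg C v < k"
        using that by (intro mult_mono) auto
      then show "?h u v \<le> k * deg C u"
        by (simp add: mult.commute)
    qed
    also have "\<dots> = card ?N * (k * deg C u)"
      by simp
    also have "\<dots> \<le> 3 * (k * deg C u)"
      using P5_free_card_nonleaf_nbrs[OF C True] by (intro mult_right_mono) auto
    finally show ?thesis
      by simp
  next
    case False
    have "(\<Sum>v\<in>nbrs C u. ?h u v) \<le> (\<Sum>v\<in>nbrs C u. 3 * k)"
    proof (rule sum_mono)
      fix v
      have "(deg C u - 1) * (deg C v - 1) \<le> 3 * k" if "deg C v < k"
        using that False by (intro mult_mono) auto
      then show "?h u v \<le> 3 * k"
        by simp
    qed
    also have "\<dots> = 3 * k * deg C u"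
      by simp
    finally show ?thesis .
  qed
  then have "(\<Sum>u<n. \<Sum>v\<in>nbrs C u. ?h u v) \<le> (\<Sum>u<n. 3 * k * deg C u)"
    by (intro sum_mono)
  also have "\<dots> \<le> 3 * k * (5 * n)"
    unfolding sum_distrib_left[symmetric] by (intro mult_left_mono P5_free_sum_deg_le[OF C]) simp
  finally show ?thesis
    using finite_nbrs[OF C(1)] unfolding arcs_sigma[OF C(1)] by (simp add: sum.Sigma)
qed

text \<open>No vertex is adjacent to both centres, so a neighbour of \<open>u\<close> has load at
  least 3 and a neighbour of \<open>v\<close> at least 2. Subtracting one from a degree discards the
  edge between the centres.\<close>

lemma pair_ok_imp_deg_le:
  assumes C: "graph_on n C" "P5_free C" and uv: "{u, v} \<in> C" "4 \<le> deg C u" "3 \<le> deg C v"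
    and ok: "pair_ok n m C B u v" and "1 \<le> m"
  shows "3 * (deg C u - 1) + 2 * (deg C v - 1) \<le> 2 * (n + m)"
proof -
  let ?S = "{..<n} - {u, v}"
  have cnt: "deg C a - 1 \<le> (\<Sum>w\<in>?S. if w \<in> nbrs C a then 1 else 0)" if "a \<in> {u, v}" for a
  proof -
    have eq: "(\<Sum>w\<in>?S. if w \<in> nbrs C a then 1 else 0) = card (nbrs C a \<inter> ?S)"
      by (subst card_eq_sum_indicator[of _ ?S]) (auto intro: sum.cong)
    have "nbrs C a \<subseteq> insert (if a = u then v else u) (nbrs C a \<inter> ?S)"
      using nbrs_subset[OF C(1), of a] that by auto
    then have "deg C a \<le> card (insert (if a = u then v else u) (nbrs C a \<inter> ?S))"
      by (intro card_mono) auto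
    also have "\<dots> \<le> Suc (card (nbrs C a \<inter> ?S))"
      by (rule card_insert_le_m1) auto
    finally show ?thesis
      unfolding eq by simp
  qed
  have "3 * (deg C u - 1) + 2 * (deg C v - 1) \<le>
      3 * (\<Sum>w\<in>?S. if w \<in> nbrs C u then 1 else 0) + 2 * (\<Sum>w\<in>?S. if w \<in> nbrs C v then 1 else 0)"
    using cnt[of u] cnt[of v] by (intro add_mono mult_left_mono) auto
  also have "\<dots> = (\<Sum>w\<in>?S. 3 * (if w \<in> nbrs C u then 1 else 0) + 2 * (if w \<in> nbrs C v then 1 else 0))"
    by (simp only: sum.distrib sum_distrib_left)
  also have "\<dots> \<le> potential n C B u v"
    unfolding potential_def
  proof (rule sum_mono)
    fix w
    have "\<not> ({u, w} \<in> C \<and> {v, w} \<in> C)"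
      using P5_free_pair_no_common_nbr[OF C uv(2,3,1)] by blast
    then show "3 * (if w \<in> nbrs C u then 1 else 0) + 2 * (if w \<in> nbrs C v then 1 else 0) \<le> load C B u v w"
      by (auto simp: load_def nbrs_def)
  qed
  \<comment> \<open>A frozen pair may exceed \<open>2 * n + m\<close> by one, which
    \<open>1 \<le> m\<close> absorbs.\<close>
  also have "\<dots> \<le> 2 * (n + m)"
    using ok \<open>1 \<le> m\<close> by (auto simp: pair_ok_def)
  finally show ?thesis .
qed

text \<open>Each large centre occurring in \<open>P\<close> has exactly one large neighbour and
  otherwise leaves. These leaves are disjoint for different centres, at most \<open>n\<close> in
  total, and \<open>double_stars_bound\<close> applies with \<open>N = n + m\<close>.\<close>

lemma sum_big_arcs_le:
  assumes inv: "blocker_inv n k m C B" and k: "4 \<le> k" and m: "1 \<le> m"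
  defines "P \<equiv> {(u, v) \<in> arcs C. u \<in> big k C \<and> v \<in> big k C}"
  shows "real (\<Sum>(u, v)\<in>P. middle_count C u v) \<le> 8 / 23 * (real n + real m)\<^sup>2"
proof -
  have C: "graph_on n C" "P5_free C"
    using inv by (simp_all add: blocker_inv_def)
  have finP: "finite P"
    using finite_arcs[OF C(1)] by (auto simp: P_def intro: finite_subset)
  have symP: "(v, u) \<in> P \<and> u \<noteq> v" if "(u, v) \<in> P" for u v
    using that graph_on_edgeD[OF C(1)] by (auto simp: P_def arcs_def insert_commute)
  have uniq: "v = w" if "(u, v) \<in> P" "w \<in> nbrs C u" "2 \<le> deg C w" for u v w
    using that k by (intro P5_free_unique_nbr[OF C, of u v w]) (auto simp: P_def arcs_def nbrs_def big_def)
  have inj: "inj_on fst P"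
  proof (rule inj_onI)
    fix p q
    assume "p \<in> P" "q \<in> P" "fst p = fst q"
    moreover from this have "snd p = snd q"
      using uniq[of "fst p" "snd p" "snd q"] k
      by (auto simp: P_def arcs_def nbrs_def big_def)
    ultimately show "p = q"
      by (simp add: prod_eq_iff)
  qed
  have half: "(\<Sum>(u, v)\<in>P. deg C u - 1) \<le> n"
  proof -
    have le: "deg C u - 1 \<le> card {w \<in> nbrs C u. deg C w = 1}" if "(u, v) \<in> P" for u v
    proof -
      have "w \<in> insert v {w \<in> nbrs C u. deg C w = 1}" if w: "w \<in> nbrs C u" for w
      proof -
        have "deg C w > 0"
          using w nbrs_sym[of w C u] finite_nbrs[OF C(1), of w] card_gt_0_iff by blast
        then show ?thesis
          using uniq[OF \<open>(u, v) \<in> P\<close> w] w by (cases "2 \<le> deg C w") auto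
      qed
      then have "deg C u \<le> card (insert v {w \<in> nbrs C u. deg C w = 1})"
        using finite_nbrs[OF C(1), of u] by (intro card_mono) auto
      also have "\<dots> \<le> Suc (card {w \<in> nbrs C u. deg C w = 1})"
        by (rule card_insert_le_m1) auto
      finally show ?thesis
        by simp
    qed
    have "(\<Sum>(u, v)\<in>P. deg C u - 1) \<le> (\<Sum>p\<in>P. card {w \<in> nbrs C (fst p). deg C w = 1})"
      using le by (intro sum_mono) auto
    also have "\<dots> = (\<Sum>u\<in>fst ` P. card {w \<in> nbrs C u. deg C w = 1})"
      using inj by (simp add: sum.reindex)
    also have "\<dots> \<le> n"
      using finP by (intro sum_leaf_nbrs_le[OF C(1)]) simp
    finally show ?thesis .
  qed
  have half': "(\<Sum>(u, v)\<in>P. deg C v - 1) = (\<Sum>(u, v)\<in>P. deg C u - 1)"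
    using symP by (intro sum_swap_pairs) auto
  define d where "d u = real (deg C u - 1)" for u
  have "(\<Sum>(u, v)\<in>P. d u * d v) \<le> 8 / 23 * (real n + real m)\<^sup>2"
  proof (rule double_stars_bound[OF finP symP])
    show "0 \<le> d u" for u
      by (simp add: d_def)
    have "(\<Sum>(u, v)\<in>P. d u + d v) = real ((\<Sum>(u, v)\<in>P. deg C u - 1) + (\<Sum>(u, v)\<in>P. deg C v - 1))"
      by (simp add: d_def sum.distrib[symmetric] split_def)
    also have "\<dots> \<le> real (2 * (n + m))"
    proof (rule of_nat_mono)
      have "a + b \<le> 2 * (n + m)" if "a \<le> n" "b = a" for a b
        using that by simp
      then show "(\<Sum>(u, v)\<in>P. deg C u - 1) + (\<Sum>(u, v)\<in>P. deg C v - 1) \<le> 2 * (n + m)"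
        using half half' .
    qed
    also have "\<dots> = 2 * (real n + real m)"
      by simp
    finally show "(\<Sum>(u, v)\<in>P. d u + d v) \<le> 2 * (real n + real m)" .
    show "3 * d u + 2 * d v \<le> 2 * (real n + real m) \<or> 3 * d v + 2 * d u \<le> 2 * (real n + real m)"
      if uv: "(u, v) \<in> P" for u v
    proof -
      have E: "{u, v} \<in> C" "{v, u} \<in> C" "u \<in> big k C" "v \<in> big k C"
        using uv by (auto simp: P_def arcs_def insert_commute)
      then have deg: "4 \<le> deg C u" "3 \<le> deg C u" "4 \<le> deg C v" "3 \<le> deg C v"
        using k by (auto simp: big_def)
      have real: "3 * d a + 2 * d b \<le> 2 * (real n + real m)"
        if "3 * (deg C a - 1) + 2 * (deg C b - 1) \<le> 2 * (n + m)" for a b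
        using of_nat_mono[OF that, where 'a = real] by (simp add: d_def)
      have "pair_ok n m C B u v \<or> pair_ok n m C B v u"
        using inv E by (simp add: blocker_inv_def)
      then show ?thesis
        using pair_ok_imp_deg_le[OF C E(1) deg(1,4) _ m] pair_ok_imp_deg_le[OF C E(2) deg(3,2) _ m]
          real by blast
    qed
  qed
  then show ?thesis
    by (simp add: d_def split_def)
qed

text \<open>Up to a term of order \<open>k * n\<close> only arcs between large centres count: in any
  other arc the end of smaller degree has degree below \<open>k\<close>.\<close>

lemma blocker_inv_score_le:
  assumes inv: "blocker_inv n k m C B" and k: "4 \<le> k" and m: "1 \<le> m"
  shows "real (score n (path_graph 4) C) \<le> 4 / 23 * (real n + real m)\<^sup>2 + 15 * real k * real n"
proof -
  have C: "graph_on n C" "P5_free C"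
    using inv by (simp_all add: blocker_inv_def)
  let ?h = "\<lambda>u v. if deg C v \<le> deg C u \<and> deg C v < k then middle_count C u v else 0"
  let ?P = "{(u, v) \<in> arcs C. u \<in> big k C \<and> v \<in> big k C}"
  have "(\<Sum>(u, v)\<in>arcs C. middle_count C u v) \<le>
      (\<Sum>(u, v)\<in>arcs C. (if (u, v) \<in> ?P then middle_count C u v else 0) + ?h u v + ?h v u)"
    by (intro sum_mono) (auto simp: big_def mult.commute)
  also have "\<dots> = (\<Sum>(u, v)\<in>arcs C. if (u, v) \<in> ?P then middle_count C u v else 0)
      + (\<Sum>(u, v)\<in>arcs C. ?h u v) + (\<Sum>(u, v)\<in>arcs C. ?h v u)"
    by (simp only: sum.distrib split_def)
  also have "(\<Sum>(u, v)\<in>arcs C. ?h v u) = (\<Sum>(u, v)\<in>arcs C. ?h u v)"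
    by (rule sum_swap_pairs) (auto simp: arcs_def insert_commute)
  also have "(\<Sum>(u, v)\<in>arcs C. if (u, v) \<in> ?P then middle_count C u v else 0) =
      (\<Sum>(u, v)\<in>?P. middle_count C u v)"
    using finite_arcs[OF C(1)] by (intro sum.mono_neutral_cong_right) (auto split: if_splits)
  finally have "(\<Sum>(u, v)\<in>arcs C. middle_count C u v) \<le>
      (\<Sum>(u, v)\<in>?P. middle_count C u v) + 2 * (\<Sum>(u, v)\<in>arcs C. ?h u v)"
    by linarith
  also have "\<dots> \<le> (\<Sum>(u, v)\<in>?P. middle_count C u v) + 2 * (15 * k * n)"
    using sum_small_arcs_le[OF C, of k] k by (intro add_left_mono mult_left_mono) auto
  finally have "2 * score n (path_graph 4) C \<le> (\<Sum>(u, v)\<in>?P. middle_count C u v) + 30 * k * n"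
    using P4_copies_le[OF C(1)] by linarith
  then have "2 * real (score n (path_graph 4) C) \<le>
      real (\<Sum>(u, v)\<in>?P. middle_count C u v) + 30 * real k * real n"
    by (metis (mono_tags, lifting) of_nat_add of_nat_le_iff of_nat_mult of_nat_numeral)
  then show ?thesis
    using sum_big_arcs_le[OF inv k m] by linarith
qed

lemma g_P4_P5_le:
  assumes k: "4 \<le> k" and m: "2 * k + 5 * n div k + 3 \<le> m"
  shows "real (g n (path_graph 4) (path_graph 5)) \<le>
    4 / 23 * (real n + real m)\<^sup>2 + 15 * real k * real n"
proof -
  let ?s = "4 / 23 * (real n + real m)\<^sup>2 + 15 * real k * real n"
  \<comment> \<open>The value is an integer, so the real bound may be rounded down.\<close>
  have "g n (path_graph 4) (path_graph 5) \<le> nat \<lfloor>?s\<rfloor>"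
    unfolding g_def
  proof (rule game_value_Constructor_le[where I = "blocker_inv n k m"])
    have "nbrs {} u = {}" for u :: nat
      by (simp add: nbrs_def)
    then have "big k {} = {}"
      using k by (simp add: big_def)
    then show "blocker_inv n k m {} {}"
      by (simp add: blocker_inv_def lonely_def P5_free_def)
    show "score n (path_graph 4) C \<le> nat \<lfloor>?s\<rfloor>" if "blocker_inv n k m C B" for C B
      by (rule le_nat_floor) (rule blocker_inv_score_le[OF that k], use m in simp)
    show "blocker_inv n k m (insert e C) B \<and> unclaimed n (insert e C) B = {} \<or>
        (\<exists>f\<in>unclaimed n (insert e C) B. blocker_inv n k m (insert e C) (insert f B))"
      if "blocker_inv n k m C B" "e \<in> constructor_moves n (path_graph 5) C B" for C B e
      by (rule blocker_inv_step[OF that(1) k m that(2)])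
  qed
  then have "real (g n (path_graph 4) (path_graph 5)) \<le> real (nat \<lfloor>?s\<rfloor>)"
    by (rule of_nat_mono)
  also have "\<dots> \<le> ?s"
    by (rule of_nat_floor) simp
  finally show ?thesis .
qed


section \<open>Constructor's strategy\<close>

definition double_star :: "'a \<Rightarrow> 'a \<Rightarrow> 'a set \<Rightarrow> 'a set \<Rightarrow> 'a set set" where
  "double_star u v L M = insert {u, v} ((\<lambda>w. {u, w}) ` L \<union> (\<lambda>w. {v, w}) ` M)"

lemma double_star_commute: "double_star u v L M = double_star v u M L"
  by (auto simp: double_star_def insert_commute)

lemma insert_left_leaf: "insert {u, w} (double_star u v L M) = double_star u v (insert w L) M"
  by (auto simp: double_star_def)

lemma leaf_edge_mem_double_star:
  assumes "u \<noteq> v" "w \<notin> {u, v}" "u \<notin> L \<union> M" "v \<notin> L \<union> M"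
  shows "{u, w} \<in> double_star u v L M \<longleftrightarrow> w \<in> L" "{v, w} \<in> double_star u v L M \<longleftrightarrow> w \<in> M"
  using assms by (auto simp: double_star_def doubleton_eq_iff)

lemma double_star_edge_meets_center: "{a, b} \<in> double_star u v L M \<Longrightarrow> a \<notin> {u, v} \<Longrightarrow> b \<in> {u, v}"
  by (auto simp: double_star_def doubleton_eq_iff)

text \<open>A vertex that is not a centre has edges to centres only; two of them would make it a
  leaf on both sides.\<close>

lemma double_star_inner_vertex:
  assumes "u \<noteq> v" "L \<inter> M = {}" "u \<notin> L \<union> M" "v \<notin> L \<union> M"
    and E: "{a, b} \<in> double_star u v L M" "{b, c} \<in> double_star u v L M" and "a \<noteq> c"
  shows "b \<in> {u, v}"
proof (rule ccontr)
  assume b: "b \<notin> {u, v}"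
  have E': "{a, b} = {b, a}"
    by (rule insert_commute)
  have "a \<in> {u, v}" "c \<in> {u, v}"
    using double_star_edge_meets_center[OF _ b] E unfolding E' by blast+
  then have "{u, b} \<in> double_star u v L M" "{v, b} \<in> double_star u v L M"
    using E \<open>a \<noteq> c\<close> by (auto simp: insert_commute)
  then have "b \<in> L \<inter> M"
    using leaf_edge_mem_double_star[OF assms(1) b assms(3,4)] by blast
  then show False
    using assms(2) by simp
qed

text \<open>The three inner vertices of a path on five vertices would all be centres, but there are
  only two.\<close>

lemma P5_free_double_star:
  assumes "u \<noteq> v" "L \<inter> M = {}" "u \<notin> L \<union> M" "v \<notin> L \<union> M"
  shows "P5_free (double_star u v L M)"
  unfolding P5_free_def
proof (intro notI, elim exE conjE)
  fix a b c d e
  assume d: "distinct [a, b, c, d, e]"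
    and E: "{a, b} \<in> double_star u v L M" "{b, c} \<in> double_star u v L M"
      "{c, d} \<in> double_star u v L M" "{d, e} \<in> double_star u v L M"
  have "b \<in> {u, v}" "c \<in> {u, v}" "d \<in> {u, v}"
    using double_star_inner_vertex[OF assms E(1,2)] double_star_inner_vertex[OF assms E(2,3)]
      double_star_inner_vertex[OF assms E(3,4)] d by simp_all
  then show False
    using d by auto
qed

lemma score_double_star_ge:
  assumes "u \<noteq> v" "L \<inter> M = {}" "u \<notin> L \<union> M" "v \<notin> L \<union> M"
    and lt: "u < n" "v < n" "L \<subseteq> {..<n}" "M \<subseteq> {..<n}"
  shows "card L * card M \<le> score n (path_graph 4) (double_star u v L M)"
proof -
  define \<phi> where "\<phi> = (\<lambda>(x, y). ({x, u, v, y}, {{x, u}, {u, v}, {v, y}}))"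
  have fin: "finite (double_star u v L M)"
    using lt finite_subset[of L "{..<n}"] finite_subset[of M "{..<n}"] by (simp add: double_star_def)
  have "\<phi> ` (L \<times> M) \<subseteq> copies (path_graph 4) ({..<n}, double_star u v L M)"
  proof (rule image_subsetI)
    fix p
    assume p: "p \<in> L \<times> M"
    then obtain x y where xy: "x \<in> L" "y \<in> M" "p = (x, y)"
      by blast
    define f where "f = (!) [x, u, v, y]"
    have "distinct [x, u, v, y]"
      using xy assms by auto
    then have "inj_on f {..<4}"
      unfolding f_def by (rule inj_on_nth) simp
    moreover have four: "{..<4} = {0, 1, 2, 3::nat}"
      by auto
    then have img: "f ` {..<4} = {x, u, v, y}"
      by (simp add: f_def)
    have i: "i = 0 \<or> i = 1 \<or> i = 2" if "Suc i < 4" for i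
      using that by linarith
    have "{{f i, f (Suc i)} |i. Suc i < 4} = {{f 0, f 1}, {f 1, f 2}, {f 2, f 3}}"
      using i by (auto simp: numeral_eq_Suc)
    then have edges: "{{f i, f (Suc i)} |i. Suc i < 4} = {{x, u}, {u, v}, {v, y}}"
      by (simp add: f_def)
    have sub: "{{x, u}, {u, v}, {v, y}} \<subseteq> double_star u v L M"
      using xy by (auto simp: double_star_def insert_commute)
    have "{f i, f (Suc i)} \<in> double_star u v L M" if "Suc i < 4" for i
    proof -
      have "{f i, f (Suc i)} \<in> {{f i, f (Suc i)} |i. Suc i < 4}"
        using that by blast
      then show ?thesis
        using sub unfolding edges by blast
    qed
    moreover have "f ` {..<4} \<subseteq> {..<n}"
      using xy lt unfolding img by auto
    ultimately have "(f ` {..<4}, {{f i, f (Suc i)} |i. Suc i < 4}) \<in>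
        copies (path_graph 4) ({..<n}, double_star u v L M)"
      unfolding copies_path_graph_iff by (intro exI[of _ f]) simp
    then show "\<phi> p \<in> copies (path_graph 4) ({..<n}, double_star u v L M)"
      unfolding edges img by (simp add: \<phi>_def xy(3))
  qed
  moreover have "inj_on \<phi> (L \<times> M)"
  proof (rule inj_onI)
    fix p q
    assume p: "p \<in> L \<times> M" and q: "q \<in> L \<times> M" and eq: "\<phi> p = \<phi> q"
    obtain x y x' y' where xy: "p = (x, y)" "q = (x', y')"
      by fastforce
    have eq': "{x, u, v, y} = {x', u, v, y'}"
      using eq by (simp add: \<phi>_def xy)
    \<comment> \<open>The two leaves are recovered from the vertex set of the path.\<close>
    have "{x, u, v, y} \<inter> L = {x}" "{x', u, v, y'} \<inter> L = {x'}"
      "{x, u, v, y} \<inter> M = {y}" "{x', u, v, y'} \<inter> M = {y'}"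
      using p q assms(2-4) unfolding xy by auto
    then have "{x} = {x'}" "{y} = {y'}"
      unfolding eq' by simp_all
    then show "p = q"
      by (simp add: xy)
  qed
  ultimately have "card (L \<times> M) \<le> card (copies (path_graph 4) ({..<n}, double_star u v L M))"
    using fin by (intro card_inj_on_le finite_copies) auto
  then show ?thesis
    by (simp add: score_def card_cartesian_product)
qed

section \<open>The two phases of Constructor's play\<close>

definition rest :: "nat \<Rightarrow> nat \<Rightarrow> nat \<Rightarrow> nat set \<Rightarrow> nat set \<Rightarrow> nat set" where
  "rest n u v L M = {..<n} - {u, v} - L - M"

definition free :: "nat \<Rightarrow> nat \<Rightarrow> nat \<Rightarrow> nat set \<Rightarrow> nat set \<Rightarrow> nat set set \<Rightarrow> nat set" where
  "free n u v L M B = {w \<in> rest n u v L M. {u, w} \<notin> B \<and> {v, w} \<notin> B}"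

text \<open>Lost for \<open>u\<close> but still available to \<open>v\<close>: the reserve that
  Constructor can leave for later. The asymmetry reflects that \<open>v\<close> is the centre that
  has its \<open>q\<close> leaves in the filling phase.\<close>

definition half_free :: "nat \<Rightarrow> nat \<Rightarrow> nat \<Rightarrow> nat set \<Rightarrow> nat set \<Rightarrow> nat set set \<Rightarrow> nat set" where
  "half_free n u v L M B = {w \<in> rest n u v L M. {u, w} \<in> B \<and> {v, w} \<notin> B}"

definition position :: "nat \<Rightarrow> nat \<Rightarrow> nat \<Rightarrow> nat set \<Rightarrow> nat set \<Rightarrow> nat set set \<Rightarrow> bool" where
  "position n u v L M C \<longleftrightarrow> u \<noteq> v \<and> u < n \<and> v < n \<and> L \<subseteq> {..<n} - {u, v} \<and> M \<subseteq> {..<n} - {u, v} \<and>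
     L \<inter> M = {} \<and> C = double_star u v L M"

text \<open>The last condition says that Blocker has not separated any vertex outside the double
  star from a centre; answering each removal at the same vertex maintains it.\<close>

definition pairing_phase :: "nat \<Rightarrow> nat \<Rightarrow> nat \<Rightarrow> nat \<Rightarrow> nat set \<Rightarrow> nat set \<Rightarrow> nat set set \<Rightarrow> nat set set \<Rightarrow> bool" where
  "pairing_phase n q u v L M C B \<longleftrightarrow> position n u v L M C \<and> card L < q \<and> card M < q \<and>
     free n u v L M B = rest n u v L M"

text \<open>The maximum allows for the last free vertex, for which Constructor has no second one to attach
  to \<open>u\<close> in exchange.\<close>

definition filling_phase :: "nat \<Rightarrow> nat \<Rightarrow> nat \<Rightarrow> nat \<Rightarrow> nat set \<Rightarrow> nat set \<Rightarrow> nat set set \<Rightarrow> nat set set \<Rightarrow> bool" where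
  "filling_phase n q u v L M C B \<longleftrightarrow> position n u v L M C \<and> q \<le> card M \<and>
     n \<le> 2 * card L + max (card (free n u v L M B)) 1 + q + 2 \<and>
     2 * n \<le> 3 * card L + 2 * card M + card (half_free n u v L M B) + 2 * card (free n u v L M B) + 4"

lemma position_commute: "position n u v L M C \<Longrightarrow> position n v u M L C"
  unfolding position_def using double_star_commute[of u v L M] by blast

lemma free_commute: "free n u v L M B = free n v u M L B" and rest_commute: "rest n u v L M = rest n v u M L"
  by (auto simp: free_def rest_def)

lemma finite_rest [simp]: "finite (rest n u v L M)"
  and finite_free [simp]: "finite (free n u v L M B)"
  and finite_half_free [simp]: "finite (half_free n u v L M B)"
  by (simp_all add: rest_def free_def half_free_def)

lemma insert_leaf_simps:
  "rest n u v (insert w L) M = rest n u v L M - {w}"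
  "rest n u v L (insert w M) = rest n u v L M - {w}"
  "free n u v (insert w L) M B = free n u v L M B - {w}"
  "free n u v L (insert w M) B = free n u v L M B - {w}"
  "half_free n u v (insert w L) M B = half_free n u v L M B - {w}"
  "half_free n u v L (insert w M) B = half_free n u v L M B - {w}"
  by (auto simp: rest_def free_def half_free_def)

lemma card_rest:
  assumes "position n u v L M C"
  shows "card (rest n u v L M) + card L + card M + 2 = n"
proof -
  have fin: "finite L" "finite M"
    using assms by (auto simp: position_def intro: finite_subset)
  have "rest n u v L M = {..<n} - insert u (insert v (L \<union> M))"
    by (auto simp: rest_def)
  moreover have sub: "insert u (insert v (L \<union> M)) \<subseteq> {..<n}"
    using assms by (auto simp: position_def)
  moreover have "card (insert u (insert v (L \<union> M))) = 2 + card L + card M"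
  proof -
    have "u \<notin> insert v (L \<union> M)" "v \<notin> L \<union> M" "card (L \<union> M) = card L + card M"
      using assms fin by (auto simp: position_def card_Un_disjoint)
    then show ?thesis
      using fin by simp
  qed
  ultimately have "card (rest n u v L M) = n - (2 + card L + card M)" "2 + card L + card M \<le> n"
    using card_mono[OF _ sub] fin by (simp_all add: card_Diff_subset)
  then show ?thesis
    by simp
qed

text \<open>The enlarged graph is again a double star, hence contains no path on five
  vertices.\<close>

lemma Constructor_takes_left:
  assumes pos: "position n u v L M C" and w: "w \<in> rest n u v L M" "{u, w} \<notin> B"
  shows "{u, w} \<in> constructor_moves n (path_graph 5) C B"
    and "position n u v (insert w L) M (insert {u, w} C)"
    and "card (insert w L) = Suc (card L)"
proof -
  show pos': "position n u v (insert w L) M (insert {u, w} C)"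
    using pos w by (auto simp: position_def rest_def insert_left_leaf)
  have "{u, w} \<notin> C"
    using pos w leaf_edge_mem_double_star(1)[of u v w L M] by (auto simp: position_def rest_def)
  moreover have "{u, w} \<in> edges (complete_graph n)"
    using pos w by (auto simp: position_def rest_def pair_edge_iff)
  moreover have "insert {u, w} C \<subseteq> edges (complete_graph n)"
    using pos' by (auto simp: position_def double_star_def pair_edge_iff)
  moreover have "P5_free (insert {u, w} C)"
  proof -
    have "insert {u, w} C = double_star u v (insert w L) M"
      using pos' by (simp add: position_def)
    moreover have "P5_free (double_star u v (insert w L) M)"
      using pos' by (intro P5_free_double_star) (auto simp: position_def)
    ultimately show ?thesis
      by simp
  qed
  ultimately show "{u, w} \<in> constructor_moves n (path_graph 5) C B"
    using w copies_P5_empty_iff by (simp add: constructor_moves_def unclaimed_def)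
  have "finite L"
    using pos by (auto simp: position_def intro: finite_subset)
  then show "card (insert w L) = Suc (card L)"
    using w by (simp add: rest_def)
qed

lemma Constructor_takes_right:
  assumes pos: "position n u v L M C" and w: "w \<in> rest n u v L M" "{v, w} \<notin> B"
  shows "{v, w} \<in> constructor_moves n (path_graph 5) C B"
    and "position n u v L (insert w M) (insert {v, w} C)"
    and "card (insert w M) = Suc (card M)"
  using Constructor_takes_left[OF position_commute[OF pos], of w B] w position_commute
  by (auto simp: rest_commute[of n v u M L])

lemma Blocker_right_edge:
  assumes "position n u v L M C" "w \<in> rest n u v L M"
  shows "free n u v L M (insert {v, w} B) = free n u v L M B - {w}"
    and "half_free n u v L M (insert {v, w} B) = half_free n u v L M B - {w}"
  using assms by (auto simp: free_def half_free_def position_def rest_def doubleton_eq_iff)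

lemma Blocker_left_edge:
  assumes "position n u v L M C" "w \<in> rest n u v L M"
  shows "free n u v L M (insert {u, w} B) = free n u v L M B - {w}"
    and "half_free n u v L M (insert {u, w} B) = half_free n u v L M B \<union> ({w} - {w. {v, w} \<in> B})"
  using assms by (auto simp: free_def half_free_def position_def rest_def doubleton_eq_iff)

lemma Blocker_other_edge:
  assumes "\<And>w. w \<in> rest n u v L M \<Longrightarrow> f \<noteq> {u, w} \<and> f \<noteq> {v, w}"
  shows "free n u v L M (insert f B) = free n u v L M B"
    and "half_free n u v L M (insert f B) = half_free n u v L M B"
  using assms by (auto simp: free_def half_free_def)

text \<open>An edge from \<open>u\<close> to a vertex already lost for \<open>v\<close> changes
  neither set and falls under \<open>other\<close>, as do all edges that do not join a centre to
  \<open>rest\<close>.\<close>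

lemma Blocker_edge_cases:
  assumes "position n u v L M C" "f \<in> unclaimed n C B"
  obtains (free_right) w where "f = {v, w}" "w \<in> free n u v L M B"
    | (half_right) w where "f = {v, w}" "w \<in> half_free n u v L M B"
    | (free_left) w where "f = {u, w}" "w \<in> free n u v L M B"
    | (other) "free n u v L M (insert f B) = free n u v L M B"
        "half_free n u v L M (insert f B) = half_free n u v L M B"
proof -
  have f: "f \<notin> B"
    using assms(2) by (simp add: unclaimed_def)
  consider w where "w \<in> rest n u v L M" "f = {v, w}" | w where "w \<in> rest n u v L M" "f = {u, w}"
    | "\<And>w. w \<in> rest n u v L M \<Longrightarrow> f \<noteq> {u, w} \<and> f \<noteq> {v, w}"
    by blast
  then show thesis
  proof cases
    case 1
    then show thesis
      using f free_right[of w] half_right[of w] by (auto simp: free_def half_free_def)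
  next
    case 2
    show thesis
    proof (cases "{v, w} \<in> B")
      case True
      then have "w \<notin> free n u v L M B"
        by (simp add: free_def)
      then show thesis
        using Blocker_left_edge[OF assms(1) 2(1), of B] True other by (simp add: 2(2))
    next
      case False
      then show thesis
        using 2 f free_left[of w] by (simp add: free_def)
    qed
  next
    case 3
    then show thesis
      using Blocker_other_edge[of n u v L M f B] other by blast
  qed
qed

lemma half_free_subset: "half_free n u v L M B \<subseteq> rest n u v L M"
  by (auto simp: half_free_def)

text \<open>The constants exceed those of \<open>filling_phase\<close> by 2 and 3, the gain from one
  more leaf at \<open>u\<close>.\<close>

lemma filling_phase_left:
  assumes "position n u v L M C" "w \<in> rest n u v L M" "{u, w} \<notin> B"
    and "q \<le> card M"
    and "n \<le> 2 * card L + max (card (free n u v L M B - {w})) 1 + q + 4"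
    and "2 * n \<le> 3 * card L + 2 * card M + card (half_free n u v L M B - {w})
      + 2 * card (free n u v L M B - {w}) + 7"
  shows "\<exists>e\<in>constructor_moves n (path_graph 5) C B. \<exists>L' M'. filling_phase n q u v L' M' (insert e C) B"
proof -
  note move = Constructor_takes_left[OF assms(1-3)]
  have "filling_phase n q u v (insert w L) M (insert {u, w} C) B"
    using move(2,3) assms(4-6) by (simp add: filling_phase_def insert_leaf_simps)
  then show ?thesis
    using move(1) by blast
qed

text \<open>A leaf at \<open>v\<close> adds 2 to the second inequality and nothing to the
  first.\<close>

lemma filling_phase_right:
  assumes "position n u v L M C" "w \<in> rest n u v L M" "{v, w} \<notin> B"
    and "q \<le> card M"
    and "n \<le> 2 * card L + max (card (free n u v L M B - {w})) 1 + q + 2"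
    and "2 * n \<le> 3 * card L + 2 * card M + card (half_free n u v L M B - {w})
      + 2 * card (free n u v L M B - {w}) + 6"
  shows "\<exists>e\<in>constructor_moves n (path_graph 5) C B. \<exists>L' M'. filling_phase n q u v L' M' (insert e C) B"
proof -
  note move = Constructor_takes_right[OF assms(1-3)]
  have "filling_phase n q u v L (insert w M) (insert {v, w} C) B"
    using move(2,3) assms(4-6) by (simp add: filling_phase_def insert_leaf_simps)
  then show ?thesis
    using move(1) by blast
qed

text \<open>In the second inequality a leaf at \<open>u\<close> weighs 3, a leaf at \<open>v\<close>
  or a free vertex 2, a half-free vertex 1. Blocker's edge and Constructor's answer together never
  lower this sum.\<close>

lemma filling_phase_step:
  assumes ph: "filling_phase n q u v L M C B" and f: "f \<in> unclaimed n C B"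
    and more: "2 \<le> card (half_free n u v L M B) + 2 * card (free n u v L M B)"
  shows "\<exists>e\<in>constructor_moves n (path_graph 5) C (insert f B).
    \<exists>L' M'. filling_phase n q u v L' M' (insert e C) (insert f B)"
proof -
  let ?X = "free n u v L M B" and ?Z = "half_free n u v L M B"
  let ?X' = "free n u v L M (insert f B)" and ?Z' = "half_free n u v L M (insert f B)"
  have pos: "position n u v L M C" and q: "q \<le> card M"
    and a: "n \<le> 2 * card L + max (card ?X) 1 + q + 2"
    and b: "2 * n \<le> 3 * card L + 2 * card M + card ?Z + 2 * card ?X + 4"
    using ph by (simp_all add: filling_phase_def)
  have disj: "?X \<inter> ?Z = {}"
    by (auto simp: free_def half_free_def)
  have X': "w \<in> rest n u v L M" "{u, w} \<notin> insert f B" "{v, w} \<notin> insert f B" "w \<notin> ?Z'" if "w \<in> ?X'" for w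
    using that by (auto simp: free_def half_free_def)
  have Z': "w \<in> rest n u v L M" "{v, w} \<notin> insert f B" "w \<notin> ?X'" if "w \<in> ?Z'" for w
    using that by (auto simp: free_def half_free_def)
  have cX: "card ?X' = Suc (card (?X' - {w}))" "?Z' - {w} = ?Z'" if "w \<in> ?X'" for w
    using that X'(4)[OF that] card_Suc_Diff1[of ?X' w] by simp_all
  have cZ: "card ?Z' = Suc (card (?Z' - {w}))" "?X' - {w} = ?X'" if "w \<in> ?Z'" for w
    using that Z'(3)[OF that] card_Suc_Diff1[of ?Z' w] by simp_all
  from pos f show ?thesis
  proof (cases rule: Blocker_edge_cases)
    case (free_right w)
    have w: "w \<in> rest n u v L M" "w \<notin> ?Z" "{u, w} \<noteq> f" "{u, w} \<notin> B"
      using free_right disj pos by (auto simp: free_def position_def doubleton_eq_iff)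
    have "?X' = ?X - {w}" "?Z' = ?Z"
      using Blocker_right_edge[OF pos w(1), of B] w(2) free_right(1) by simp_all
    moreover have "card ?X = Suc (card (?X - {w}))"
      using card_Suc_Diff1[of ?X w] free_right(2) by simp
    ultimately show ?thesis
      using w a b q by (intro filling_phase_left[OF pos w(1)]) auto
  next
    case (half_right w)
    have w: "w \<in> rest n u v L M" "w \<notin> ?X"
      using half_right disj half_free_subset by blast+
    have eq: "?X' = ?X" "?Z' = ?Z - {w}"
      using Blocker_right_edge[OF pos w(1), of B] w(2) half_right(1) by simp_all
    have cw: "card ?Z = Suc (card ?Z')"
      using card_Suc_Diff1[of ?Z w] half_right(2) by (simp add: eq)
    show ?thesis
    proof (cases "?Z' = {}")
      case False
      then obtain w' where w': "w' \<in> ?Z'"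
        by blast
      show ?thesis
        using Z'[OF w'] cZ[OF w'] eq(1) cw a b q by (intro filling_phase_right[OF pos, of w']) auto
    next
      case True
      \<comment> \<open>By \<open>more\<close>, the half-free vertex just lost was not the only
        vertex left.\<close>
      then have "?X' \<noteq> {}"
        using more cw eq(1) by auto
      then obtain w' where w': "w' \<in> ?X'"
        by blast
      show ?thesis
        using X'[OF w'] cX[OF w'] eq(1) cw a b q by (intro filling_phase_left[OF pos, of w']) auto
    qed
  next
    case (free_left w)
    have w: "w \<in> rest n u v L M" "{v, w} \<noteq> f" "{v, w} \<notin> B" "w \<notin> ?Z"
      using free_left disj pos by (auto simp: free_def position_def doubleton_eq_iff)
    have eq: "?X' = ?X - {w}" "?Z' = insert w ?Z"
      using Blocker_left_edge[OF pos w(1), of B] w(3) free_left(1) by auto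
    have cw: "card ?X = Suc (card ?X')" "card ?Z' = Suc (card ?Z)"
      using card_Suc_Diff1[of ?X w] free_left(2) w(4) by (simp_all add: eq)
    show ?thesis
    proof (cases "?X' = {}")
      case False
      \<comment> \<open>Constructor keeps \<open>w\<close> in reserve for \<open>v\<close> and gives
        another free vertex to \<open>u\<close>.\<close>
      then obtain w' where w': "w' \<in> ?X'"
        by blast
      show ?thesis
        using X'[OF w'] cX[OF w'] cw a b q by (intro filling_phase_left[OF pos, of w']) auto
    next
      case True
      \<comment> \<open>The last free vertex goes to \<open>v\<close>; the maximum in the first
        inequality remains 1.\<close>
      have w': "w \<in> ?Z'"
        by (simp add: eq)
      show ?thesis
        using Z'[OF w'] cZ[OF w'] cw a b q True by (intro filling_phase_right[OF pos, of w]) auto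
    qed
  next
    case other
    show ?thesis
    proof (cases "?X' = {}")
      case False
      then obtain w' where w': "w' \<in> ?X'"
        by blast
      show ?thesis
        using X'[OF w'] cX[OF w'] other a b q by (intro filling_phase_left[OF pos, of w']) auto
    next
      case True
      then have "?Z' \<noteq> {}"
        using more other by auto
      then obtain w' where w': "w' \<in> ?Z'"
        by blast
      show ?thesis
        using Z'[OF w'] cZ[OF w'] other a b q by (intro filling_phase_right[OF pos, of w']) auto
    qed
  qed
qed

definition constructor_inv :: "nat \<Rightarrow> nat \<Rightarrow> nat set set \<Rightarrow> nat set set \<Rightarrow> bool" where
  "constructor_inv n q C B \<longleftrightarrow>
     (\<exists>u v L M. pairing_phase n q u v L M C B \<or> filling_phase n q u v L M C B)"

text \<open>When \<open>u\<close> reaches \<open>q\<close> leaves, the centres swap roles. As no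
  vertex has been lost, both inequalities of the filling phase follow by counting vertices.\<close>

lemma pairing_phase_continue:
  assumes pos: "position n u v L M C" and "card L \<le> q" "card M < q"
    and all: "free n u v L M B = rest n u v L M"
  shows "constructor_inv n q C B"
proof (cases "card L < q")
  case True
  then have "pairing_phase n q u v L M C B"
    using assms by (simp add: pairing_phase_def)
  then show ?thesis
    by (auto simp: constructor_inv_def)
next
  case False
  have "free n v u M L B = rest n u v L M"
    using all free_commute by simp
  then have "filling_phase n q v u M L C B"
    using False assms card_rest[OF pos] position_commute[OF pos]
    by (simp add: filling_phase_def)
  then show ?thesis
    by (auto simp: constructor_inv_def)
qed

lemma pairing_phase_left:
  assumes pos: "position n u v L M C" and w: "w \<in> rest n u v L M" "{u, w} \<notin> B"
    and q: "card L < q" "card M < q"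
    and all: "free n u v L M B - {w} = rest n u v L M - {w}"
  shows "\<exists>e\<in>constructor_moves n (path_graph 5) C B. constructor_inv n q (insert e C) B"
proof -
  note move = Constructor_takes_left[OF pos w]
  have "constructor_inv n q (insert {u, w} C) B"
    using move(2,3) q all by (intro pairing_phase_continue[OF move(2)]) (auto simp: insert_leaf_simps)
  then show ?thesis
    using move(1) by blast
qed

text \<open>A vertex removed from one centre is attached to the other, so the vertices outside the
  double star stay free. With \<open>2 * q < n\<close> one is available even if Blocker plays
  elsewhere.\<close>

lemma pairing_phase_step:
  assumes ph: "pairing_phase n q u v L M C B" and f: "f \<in> unclaimed n C B" and q: "2 * q < n"
  shows "\<exists>e\<in>constructor_moves n (path_graph 5) C (insert f B). constructor_inv n q (insert e C) (insert f B)"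
proof -
  have pos: "position n u v L M C" and lt: "card L < q" "card M < q"
    and all: "free n u v L M B = rest n u v L M"
    using ph by (simp_all add: pairing_phase_def)
  from pos f show ?thesis
  proof (cases rule: Blocker_edge_cases)
    case (free_right w)
    then have w: "w \<in> rest n u v L M" "{u, w} \<notin> insert f B"
      using pos by (auto simp: free_def position_def doubleton_eq_iff)
    show ?thesis
      using Blocker_right_edge(1)[OF pos w(1), of B] free_right(1) all
      by (intro pairing_phase_left[OF pos w lt]) auto
  next
    case (free_left w)
    then have w: "w \<in> rest n v u M L" "{v, w} \<notin> insert f B"
      using pos by (auto simp: free_def position_def doubleton_eq_iff rest_commute)
    have "free n v u M L (insert f B) = rest n v u M L - {w}"
      using Blocker_left_edge(1)[OF pos, of w B] w(1) free_left(1) all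
      by (simp add: free_commute[of n v u] rest_commute[of n v u])
    then show ?thesis
      by (intro pairing_phase_left[OF position_commute[OF pos] w lt(2,1)]) auto
  next
    case (half_right w)
    then show ?thesis
      using all by (auto simp: free_def half_free_def)
  next
    case other
    have "card (rest n u v L M) > 0"
      using card_rest[OF pos] lt q by linarith
    then obtain w where "w \<in> rest n u v L M"
      by (metis card.empty equals0I less_numeral_extra(3))
    moreover from this have "{u, w} \<notin> insert f B"
      using other(1) all by (auto simp: free_def)
    ultimately show ?thesis
      using other(1) all by (intro pairing_phase_left[OF pos _ _ lt]) auto
  qed
qed


text \<open>The product of \<open>a - 2n/7\<close> and \<open>b - 3n/7\<close> is nonnegative up to lower-order terms, which bounds
  \<open>a b\<close> from below by the linear form \<open>3 a + 2 b\<close> times \<open>n/7\<close>.\<close>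

lemma filling_phase_final_product:
  fixes a b n q :: nat
  assumes "q = 3 * n div 7" "q \<le> b" "n \<le> 2 * a + q + 3" "2 * n \<le> 3 * a + 2 * b + 5" "a + b \<le> n"
  shows "8 / 49 * (real n)\<^sup>2 - 2 * real n - 2 \<le> real (a * b)"
proof -
  define x y N where "x = real a" "y = real b" "N = real n"
  have "7 * q \<le> 3 * n" "3 * n \<le> 7 * q + 6"
    using assms(1) by linarith+
  then have q: "7 * real q \<le> 3 * N" "3 * N \<le> 7 * real q + 6"
    unfolding x_y_N_def by linarith+
  have r: "real q \<le> y" "N \<le> 2 * x + real q + 3" "2 * N \<le> 3 * x + 2 * y + 5" "x + y \<le> N" "0 \<le> x"
    using assms(2-5) unfolding x_y_N_def by linarith+
  \<comment> \<open>Nonnegativity of the factors comes from \<open>n \<le> 2 * a + q + 3\<close> and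
    \<open>q \<le> b\<close>. The shift \<open>3 / 2\<close> is half of the constant 3, and the
    shift 1 covers the rounding in \<open>q\<close>.\<close>
  have "0 \<le> (x - (2 / 7 * N - 3 / 2)) * (y - (3 / 7 * N - 1))"
    using q r by (intro mult_nonneg_nonneg) linarith+
  moreover have "0 \<le> N * (3 * x + 2 * y + 5 - 2 * N)"
    using r unfolding x_y_N_def by (intro mult_nonneg_nonneg) auto
  moreover have "x + 3 / 2 * y \<le> 3 / 2 * N"
    using r by linarith
  moreover have "x * y - 8 / 49 * N\<^sup>2 =
      (x - (2 / 7 * N - 3 / 2)) * (y - (3 / 7 * N - 1)) + N * (3 * x + 2 * y + 5 - 2 * N) / 7
      - (x + 3 / 2 * y) + 3 / 14 * N - 3 / 2"
    by (simp add: field_simps power2_eq_square)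
  moreover have "0 \<le> N"
    by (simp add: x_y_N_def)
  ultimately have "8 / 49 * N\<^sup>2 - 2 * N - 2 \<le> x * y"
    by linarith
  then show ?thesis
    by (simp add: x_y_N_def)
qed

text \<open>Play can stop only in the filling phase, with no free and at most one half-free vertex;
  then its two inequalities become the hypotheses of
  \<open>filling_phase_final_product\<close>.\<close>

lemma constructor_inv_step:
  assumes inv: "constructor_inv n q C B" and q: "q = 3 * n div 7" "0 < n"
    and s: "s = nat \<lceil>8 / 49 * (real n)\<^sup>2 - 2 * real n - 2\<rceil>"
  shows "s \<le> score n (path_graph 4) C \<or> unclaimed n C B \<noteq> {} \<and>
    (\<forall>f\<in>unclaimed n C B. \<exists>e\<in>constructor_moves n (path_graph 5) C (insert f B).
      constructor_inv n q (insert e C) (insert f B))"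
proof -
  have nonempty: "unclaimed n C B \<noteq> {}" if "position n u v L M C" "w \<in> rest n u v L M" "{v, w} \<notin> B" for u v L M w
    using Constructor_takes_right(1)[OF that] by (auto simp: constructor_moves_def)
  have q2: "2 * q < n"
    using q by linarith
  obtain u v L M where "pairing_phase n q u v L M C B \<or> filling_phase n q u v L M C B"
    using inv by (auto simp: constructor_inv_def)
  then show ?thesis
  proof
    assume ph: "pairing_phase n q u v L M C B"
    then have pos: "position n u v L M C" and "card L < q" "card M < q"
      and all: "free n u v L M B = rest n u v L M"
      by (simp_all add: pairing_phase_def)
    then have "card (rest n u v L M) > 0"
      using card_rest[OF pos] q2 by linarith
    then obtain w where w: "w \<in> rest n u v L M"
      by (metis card.empty equals0I less_numeral_extra(3))
    then have "{v, w} \<notin> B"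
      using all by (auto simp: free_def)
    then show ?thesis
      using nonempty[OF pos w] pairing_phase_step[OF ph _ q2] by blast
  next
    assume ph: "filling_phase n q u v L M C B"
    then have pos: "position n u v L M C"
      by (simp add: filling_phase_def)
    show ?thesis
    proof (cases "2 \<le> card (half_free n u v L M B) + 2 * card (free n u v L M B)")
      case True
      then have "free n u v L M B \<union> half_free n u v L M B \<noteq> {}"
        by auto
      then obtain w where "w \<in> rest n u v L M" "{v, w} \<notin> B"
        by (auto simp: free_def half_free_def)
      then have "unclaimed n C B \<noteq> {}"
        using nonempty[OF pos] by blast
      moreover have "\<exists>e\<in>constructor_moves n (path_graph 5) C (insert f B).
          constructor_inv n q (insert e C) (insert f B)" if "f \<in> unclaimed n C B" for f
        using filling_phase_step[OF ph that True] unfolding constructor_inv_def by blast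
      ultimately show ?thesis
        by blast
    next
      case False
      then have "card (free n u v L M B) = 0" "card (half_free n u v L M B) \<le> 1"
        by linarith+
      then have "8 / 49 * (real n)\<^sup>2 - 2 * real n - 2 \<le> real (card L * card M)"
        using ph card_rest[OF pos] q(1)
        by (intro filling_phase_final_product[of q]) (simp_all add: filling_phase_def)
      moreover have "card L * card M \<le> score n (path_graph 4) C"
        using pos score_double_star_ge[of u v L M n] by (auto simp: position_def)
      ultimately have "8 / 49 * (real n)\<^sup>2 - 2 * real n - 2 \<le> real (score n (path_graph 4) C)"
        by linarith
      then show ?thesis
        unfolding s nat_ceiling_le_eq ..
    qed
  qed
qed

section \<open>The value of the game\<close>

lemma g_P4_P5_ge:
  "8 / 49 * (real n)\<^sup>2 - 2 * real n - 2 \<le> real (g n (path_graph 4) (path_graph 5))"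
proof (cases "3 \<le> n")
  case True
  define s where "s = nat \<lceil>8 / 49 * (real n)\<^sup>2 - 2 * real n - 2\<rceil>"
  define e :: "nat set" where "e = {0, 1}"
  have pos: "position n 0 1 {} {} {e}"
    using True by (simp add: position_def double_star_def e_def)
  have e: "e \<in> constructor_moves n (path_graph 5) {} {}"
  proof -
    have "e \<in> edges (complete_graph n)"
      using True by (simp add: e_def pair_edge_iff)
    moreover have "{e} = double_star 0 1 {} {}"
      by (simp add: double_star_def e_def)
    then have "P5_free {e}"
      using P5_free_double_star[of "0 :: nat" 1 "{}" "{}"] by simp
    ultimately show ?thesis
      using copies_P5_empty_iff[of "{e}" n] by (simp add: constructor_moves_def unclaimed_def)
  qed
  \<comment> \<open>From \<open>3 \<le> n\<close> on the threshold \<open>3 * n div 7\<close> is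
    positive, so the empty leaf sets lie below it.\<close>
  have "pairing_phase n (3 * n div 7) 0 1 {} {} {e} {}"
    using pos True by (auto simp: pairing_phase_def free_def)
  then have "constructor_inv n (3 * n div 7) {e} {}"
    by (auto simp: constructor_inv_def)
  then have "s \<le> game_value n (path_graph 4) (path_graph 5) Blocker {e} {}"
  proof (rule game_value_Blocker_ge)
    show "s \<le> score n (path_graph 4) C \<or> unclaimed n C B \<noteq> {} \<and>
        (\<forall>f\<in>unclaimed n C B. \<exists>e\<in>constructor_moves n (path_graph 5) C (insert f B).
          constructor_inv n (3 * n div 7) (insert e C) (insert f B))"
      if "constructor_inv n (3 * n div 7) C B" for C B
      using True by (intro constructor_inv_step[OF that refl _ s_def]) simp
  qed simp
  also have "\<dots> \<le> g n (path_graph 4) (path_graph 5)"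
    using e unfolding g_def
    by (subst (2) game_value.simps)
      (auto simp: game_over_def constructor_moves_def intro!: Max_ge finite_imageI finite_subset[OF _ finite_unclaimed])
  finally show ?thesis
    unfolding s_def nat_ceiling_le_eq .
next
  case False
  \<comment> \<open>For \<open>n\<close> at most 2 the left-hand side is negative.\<close>
  then have "real n * real n \<le> 2 * real n"
    by (intro mult_right_mono) auto
  then show ?thesis
    by (simp add: power2_eq_square)
qed

text \<open>Taking \<open>k\<close> of order \<open>sqrt n\<close> balances \<open>k\<close> against
  \<open>n / k\<close>, so that the errors from \<open>m\<close> and from the small stars are both
  of order \<open>n * sqrt n\<close>.\<close>

lemma g_P4_P5_le_sqrt:
  "real (g n (path_graph 4) (path_graph 5)) \<le> 4 / 23 * (real n)\<^sup>2 + (200 * (real n * sqrt (real n)) + 100)"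
proof -
  define r where "r = sqrt (real n)"
  \<comment> \<open>The summand 4 ensures \<open>4 \<le> k\<close> for every
    \<open>n\<close>.\<close>
  define k where "k = nat \<lceil>r\<rceil> + 4"
  define m where "m = 2 * k + 5 * n div k + 3"
  have r: "0 \<le> r" "real n = r * r"
    by (simp_all add: r_def)
  have k: "r \<le> real k" "real k \<le> r + 5"
    using r(1) unfolding k_def by linarith+
  have "real n \<le> r * real k" "0 < real k"
    using mult_left_mono[OF k(1) r(1)] r(2) by (simp_all add: k_def)
  then have "5 * real n / real k \<le> 5 * r"
    by (simp add: divide_le_eq)
  then have "real (5 * n div k) \<le> 5 * r"
    using of_nat_div_le_of_nat[of "5 * n" k, where 'a = real] by simp
  then have m: "real m \<le> 7 * r + 13"
    using k(2) by (simp add: m_def)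
  have "real (g n (path_graph 4) (path_graph 5)) \<le> 4 / 23 * (real n + real m)\<^sup>2 + 15 * real k * real n"
    by (rule g_P4_P5_le) (simp_all add: k_def m_def)
  also have "\<dots> \<le> 4 / 23 * (real n + (7 * r + 13))\<^sup>2 + 15 * (r + 5) * real n"
    using k m by (intro add_mono mult_left_mono power_mono mult_right_mono) auto
  also have "\<dots> \<le> 4 / 23 * (real n)\<^sup>2 + (200 * (real n * r) + 100)"
  proof (cases "n = 0")
    case True
    then show ?thesis
      using r by (simp add: power2_eq_square)
  next
    case False
    then have "1 \<le> r"
      by (simp add: r_def)
    then have "r \<le> r * r" "r * r \<le> r * r * r"
      using mult_left_mono[of 1 r r] mult_left_mono[of 1 r "r * r"] by simp_all
    moreover have "4 / 23 * (r * r + (7 * r + 13))\<^sup>2 + 15 * (r + 5) * (r * r) =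
        4 / 23 * (r * r)\<^sup>2 + 401 / 23 * (r * r * r) + 2025 / 23 * (r * r) + 728 / 23 * r + 676 / 23"
      by (simp add: power2_eq_square field_simps)
    ultimately show ?thesis
      unfolding r(2) using r(1) by linarith
  qed
  finally show ?thesis
    by (simp add: r_def)
qed

theorem theorem1p4:
  "\<exists>\<epsilon>\<^sub>1 \<epsilon>\<^sub>2 :: nat \<Rightarrow> real.
     \<epsilon>\<^sub>1 \<in> o(\<lambda>n. (real n)\<^sup>2) \<and> \<epsilon>\<^sub>2 \<in> o(\<lambda>n. (real n)\<^sup>2) \<and>
     (\<forall>n. 8 / 49 * (real n)\<^sup>2 - \<epsilon>\<^sub>1 n \<le> real (g n (path_graph 4) (path_graph 5)) \<and>
          real (g n (path_graph 4) (path_graph 5)) \<le> 4 / 23 * (real n)\<^sup>2 + \<epsilon>\<^sub>2 n)"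
proof (intro exI conjI allI)
  show "(\<lambda>n. 2 * real n + 2) \<in> o(\<lambda>n. (real n)\<^sup>2)"
    by real_asymp
  show "(\<lambda>n. 200 * (real n * sqrt (real n)) + 100) \<in> o(\<lambda>n. (real n)\<^sup>2)"
    by real_asymp
  show "8 / 49 * (real n)\<^sup>2 - (2 * real n + 2) \<le> real (g n (path_graph 4) (path_graph 5))" for n
    using g_P4_P5_ge[of n] by simp
  show "real (g n (path_graph 4) (path_graph 5)) \<le>
      4 / 23 * (real n)\<^sup>2 + (200 * (real n * sqrt (real n)) + 100)" for n
    by (rule g_P4_P5_le_sqrt)
qed

end
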